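(* Let $\mathcal{G}=(\mathcal{V},\mathcal{E},A)$ be an undirected connected weighted graph with $\mathcal{V}=\{1,\dots,N\}$ and weighted adjacency matrix $A=[a_{ij}]$. For $i=1,\dots,N$ let $f_i:\mathbb{R}^n\times\mathbb{R}_+\to\mathbb{R}$ satisfy: (1) $f_i$ is twice continuously differentiable with respect to $x$, $\underline{\theta}_i$-strongly convex and $\bar\theta_i$-smooth in $x$ for some positive scalars $\underline{\theta}_i,\bar\theta_i$, i.e. $\underline{\theta}_i I_n\le H_i(x,t)\le\bar\theta_i I_n$ for all $x,t$, where $H_i(x,t)$ is the Hessian of $f_i$ with respect to $x$; (2) $\frac{\partial\nabla f_i(x,t)}{\partial t}$ is measurable with respect to $t$ and $\big\|\frac{\partial\nabla f_i(x,t)}{\partial t}\big\|\le\kappa$ for all $x,t$, for some $\kappa>0$ (common to all $i$). For each $i$ let $\varphi_i:\mathbb{R}^n\to\mathbb{R}^n$ be such that the system $\dot z_i=-\varphi_i(z_i)$ is finite-time stable at the origin. Set $\underline\theta=\min_i\underline\theta_i$ and $\bar\theta=\max_i\bar\theta_i$. Consider the distributed protocol, for $i=1,\dots,N$, $$\dot x_i=-H_i^{-1}(x_i,t)\Big(\varphi_i(z_i)+\frac{\partial\nabla f_i(x_i,t)}{\partial t}+\alpha\sum_{j=1}^N a_{ij}\,\mathrm{sgn}(x_i-x_j)\Big),\qquad \dot z_i=-\varphi_i(z_i),$$ with $z_i(0)=\nabla f_i(x_i(0),0)$ and $$\alpha>\kappa\sqrt{\frac{N\bar\theta}{\underline\theta\,\lambda_2(B^TB)}}.$$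 Then every $z_i(t)$ converges to $0$ in finite time, and then every $x_i(t)$ tracks in finite time the optimal trajectory $x^*(t)$ of the problem $$\min_{x_1,\dots,x_N\in\mathbb{R}^n}\ \sum_{i=1}^N f_i(x_i,t)\quad\text{s.t. } x_i=x_j\ \ \forall (i,j)\in\mathcal{E},$$ i.e. there exists $T<\infty$ such that $\lim_{t\to T}\|x_i(t)-x^*(t)\|=0$ for all $i\in\{1,\dots,N\}$.
   Context: $\nabla$ denotes the gradient with respect to $x$, $\|\cdot\|$ is the Euclidean norm, and $\mathrm{sgn}(\cdot)$ is the componentwise sign function (with $\mathrm{sgn}(0)=0$). The adjacency matrix is symmetric, with $a_{ij}>0$ iff $(j,i)\in\mathcal{E}$ and $a_{ii}=0$. Since $\mathcal{G}$ is connected, the constrained problem is equivalent to $\min_{x\in\mathbb{R}^n}\sum_{i=1}^N f_i(x,t)$, whose unique minimizer at time $t$ is $x^*(t)$ (all $x_i$ equal to $x^*(t)$ at the optimum). Weighted incidence matrix: with $m=|\mathcal{E}|$ the number of (undirected) edges, $B_0=[b_{ik}]\in\mathbb{R}^{N\times m}$ is defined by $b_{ik}=-b_{jk}=a_{ij}$ if $i<j$ for each edge $e_k=\{i,j\}\in\mathcal{E}$, all other entries being $0$; and $B=B_0\otimes I_n$. For a positive semidefinite matrix $M$, $\lambda_2(M)$ denotes its smallest positive eigenvalue. Finite-time stability: a system $\dot z=h(z)$ on $\mathbb{R}^n$ is finite-time (FT) stable at the origin if it is Lyapunov stable and there exists a finite settling time $T(z_0)$ such that $\lim_{t\to T(z_0)}z(t;z_0)=0$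 and $z(t;z_0)=0$ for all $t\ge T(z_0)$, for any solution starting from $z_0\in\mathcal{X}_0$, where $\mathcal{X}_0$ is a set of initial states; it is globally FT stable when $\mathcal{X}_0=\mathbb{R}^n$. The initial values $z_i(0)$ are understood to belong to the corresponding sets $\mathcal{X}_0$ (no restriction in the global case). Since the right-hand side of the protocol is discontinuous, solutions are understood in the sense of Filippov (absolutely continuous solutions of the differential inclusion given by the Filippov set-valued map).
   Formalization: The formal theorem additionally assumes that the time derivative of each gradient is continuous in x and that each φ_i is locally essentially bounded; without these the claim fails for Filippov solutions. *)

theory Defs
  imports "HOL-Analysis.Analysis"
begin

section \<open>Filippov solutions\<close>

text \<open>
  The sets \<open>S\<close> range over the Lebesgue null sets of the state space; time is kept fixed.
\<close>

definition filippov_map ::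
  "(real \<Rightarrow> 'a::euclidean_space \<Rightarrow> 'a) \<Rightarrow> real \<Rightarrow> 'a \<Rightarrow> 'a set" where
  "filippov_map h t y =
    (\<Inter>\<delta>\<in>{0<..}. \<Inter>S\<in>{S. negligible S}. closure (convex hull (h t ` (ball y \<delta> - S))))"

definition absolutely_continuous_fun ::
  "real \<Rightarrow> real \<Rightarrow> (real \<Rightarrow> 'a::real_normed_vector) \<Rightarrow> bool" where
  "absolutely_continuous_fun a b y \<longleftrightarrow>
    (\<forall>\<epsilon>>0. \<exists>\<delta>>0. \<forall>(n::nat) u v.
       (\<forall>k<n. a \<le> u k \<and> u k \<le> v k \<and> v k \<le> b) \<and>
       (\<forall>k<n. \<forall>l<n. k \<noteq> l \<longrightarrow> {u k<..<v k} \<inter> {u l<..<v l} = {}) \<and>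
       (\<Sum>k<n. v k - u k) < \<delta> \<longrightarrow>
       (\<Sum>k<n. norm (y (v k) - y (u k))) < \<epsilon>)"

definition filippov_solution ::
  "(real \<Rightarrow> 'a::euclidean_space \<Rightarrow> 'a) \<Rightarrow> (real \<Rightarrow> 'a) \<Rightarrow> bool" where
  "filippov_solution h y \<longleftrightarrow>
    (\<forall>b\<ge>0. absolutely_continuous_fun 0 b y) \<and>
    (AE t in lebesgue. 0 \<le> t \<longrightarrow>
       (\<exists>v\<in>filippov_map h t (y t). (y has_vector_derivative v) (at t)))"

text \<open>The standing assumption under which the Filippov map of a vector field is locally bounded.\<close>

definition locally_essentially_bounded :: "('a::euclidean_space \<Rightarrow> 'a) \<Rightarrow> bool" where
  "locally_essentially_bounded h \<longleftrightarrow>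
    (\<forall>y. \<exists>r>0. \<exists>C S. negligible S \<and> (\<forall>w\<in>ball y r - S. norm (h w) \<le> C))"


section \<open>Finite-time stability of the origin\<close>

definition lyapunov_stable :: "('a::euclidean_space \<Rightarrow> 'a) \<Rightarrow> bool" where
  "lyapunov_stable h \<longleftrightarrow>
    (\<forall>\<epsilon>>0. \<exists>\<delta>>0. \<forall>z. filippov_solution (\<lambda>_. h) z \<and> norm (z 0) < \<delta> \<longrightarrow>
       (\<forall>t\<ge>0. norm (z t) < \<epsilon>))"

text \<open>
  Used both for the settling time of a solution and for the convergence claim on \<open>z\<^sub>i\<close>.
  The bound \<open>0 \<le> T\<close> matters: for negative \<open>T\<close> the filter \<open>at T within {0..}\<close> is trivial.
\<close>

definition settles_at :: "(real \<Rightarrow> 'a::euclidean_space) \<Rightarrow> real \<Rightarrow> bool" where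
  "settles_at z T \<longleftrightarrow> 0 \<le> T \<and> (z \<longlongrightarrow> 0) (at T within {0..}) \<and> (\<forall>t\<ge>T. z t = 0)"

text \<open>
  The settling time depends on the initial state only. The global notion is \<open>X0 = UNIV\<close>.
\<close>

definition ft_stable :: "('a::euclidean_space \<Rightarrow> 'a) \<Rightarrow> 'a set \<Rightarrow> bool" where
  "ft_stable h X0 \<longleftrightarrow>
    lyapunov_stable h \<and>
    (\<forall>z0\<in>X0. \<exists>T. \<forall>z. filippov_solution (\<lambda>_. h) z \<and> z 0 = z0 \<longrightarrow> settles_at z T)"


section \<open>Graphs and matrices\<close>

text \<open>
  An undirected edge \<open>{i, j}\<close> is represented in \<open>E\<close> by the two pairs \<open>(i, j)\<close> and \<open>(j, i)\<close>.
\<close>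

definition undirected_weighted_graph :: "('v::finite \<times> 'v) set \<Rightarrow> real^'v^'v \<Rightarrow> bool" where
  "undirected_weighted_graph E A \<longleftrightarrow>
    transpose A = A \<and>
    (\<forall>i. A $ i $ i = 0) \<and>
    (\<forall>i j. 0 \<le> A $ i $ j) \<and>
    (\<forall>i j. 0 < A $ i $ j \<longleftrightarrow> (j, i) \<in> E)"

definition connected_graph :: "('v \<times> 'v) set \<Rightarrow> bool" where
  "connected_graph E \<longleftrightarrow> (\<forall>i j. (i, j) \<in> E\<^sup>*)"

definition undirected_edges :: "('v \<times> 'v) set \<Rightarrow> 'v set set" where
  "undirected_edges E = {{i, j} | i j. (i, j) \<in> E}"

text \<open>
  The columns are indexed by a type \<open>'m\<close> through an enumeration \<open>e\<close> of the undirected edges.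
  If \<open>e k = {i, j}\<close> with \<open>i < j\<close>, then \<open>i = Min (e k)\<close> and \<open>j = Max (e k)\<close>.
\<close>

definition weighted_incidence ::
  "real^'v::{finite,linorder}^'v::{finite,linorder} \<Rightarrow> ('m::finite \<Rightarrow> 'v set) \<Rightarrow>
   real^'m^'v::{finite,linorder}" where
  "weighted_incidence A e = (\<chi> i k.
     if i = Min (e k) then A $ Min (e k) $ Max (e k)
     else if i = Max (e k) then - (A $ Min (e k) $ Max (e k))
     else 0)"

definition kronecker ::
  "real^'b^'a \<Rightarrow> real^'d^'c \<Rightarrow> real^('b::finite \<times> 'd::finite)^('a::finite \<times> 'c::finite)" where
  "kronecker P Q = (\<chi> p q. P $ fst p $ fst q * Q $ snd p $ snd q)"

definition real_eigenvalue :: "real^'k^'k \<Rightarrow> real \<Rightarrow> bool" where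
  "real_eigenvalue M l \<longleftrightarrow> (\<exists>v. v \<noteq> 0 \<and> M *v v = l *\<^sub>R v)"

definition lambda2 :: "real^'k^'k \<Rightarrow> real" where
  "lambda2 M = (LEAST l. 0 < l \<and> real_eigenvalue M l)"

definition positive_semidefinite :: "real^'k^'k \<Rightarrow> bool" where
  "positive_semidefinite M \<longleftrightarrow> transpose M = M \<and> (\<forall>v. 0 \<le> v \<bullet> (M *v v))"

definition loewner_le :: "real^'k^'k \<Rightarrow> real^'k^'k \<Rightarrow> bool" where
  "loewner_le P Q \<longleftrightarrow> positive_semidefinite (Q - P)"


section \<open>Optimization problem and protocol\<close>

text \<open>
  For a connected graph the feasible points of the constrained problem are exactly the tuples
  with all components equal, so its minimizer is given by a single vector.
\<close>

definition optimal_trajectory ::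
  "('v::finite \<Rightarrow> real^'n \<Rightarrow> real \<Rightarrow> real) \<Rightarrow> ('v \<times> 'v) set \<Rightarrow> real \<Rightarrow> real^'n" where
  "optimal_trajectory f E t =
    (THE y. is_arg_min (\<lambda>Y :: (real^'n)^'v. \<Sum>i\<in>UNIV. f i (Y $ i) t)
                       (\<lambda>Y. \<forall>(i, j)\<in>E. Y $ i = Y $ j) (\<chi> i. y))"

text \<open>The library's \<open>sgn\<close> on vectors is normalization, not the componentwise sign.\<close>

definition sgn_vec :: "real^'n \<Rightarrow> real^'n" where
  "sgn_vec x = (\<chi> k. sgn (x $ k))"

text \<open>
  Right-hand side for the joint state \<open>(X, Z)\<close>, with \<open>H i x t\<close> the Hessian of \<open>f\<^sub>i\<close> and
  \<open>dg i x t\<close> the time derivative of its gradient.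
\<close>

definition protocol_rhs ::
  "real^'v^'v \<Rightarrow> real \<Rightarrow> ('v \<Rightarrow> real^'n \<Rightarrow> real \<Rightarrow> real^'n^'n) \<Rightarrow>
   ('v \<Rightarrow> real^'n \<Rightarrow> real \<Rightarrow> real^'n) \<Rightarrow> ('v \<Rightarrow> real^'n \<Rightarrow> real^'n) \<Rightarrow>
   real \<Rightarrow> ((real^'n)^'v) \<times> ((real^'n)^'v) \<Rightarrow> ((real^'n)^'v) \<times> ((real^'n)^'v)" where
  "protocol_rhs A \<alpha> H dg \<phi> t = (\<lambda>(X, Z).
     ((\<chi> i. - (matrix_inv (H i (X $ i) t) *v
                (\<phi> i (Z $ i) + dg i (X $ i) t
                 + \<alpha> *\<^sub>R (\<Sum>j\<in>UNIV. A $ i $ j *\<^sub>R sgn_vec (X $ i - X $ j))))),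
      (\<chi> i. - \<phi> i (Z $ i))))"

end

theory Submission
  imports Defs
begin

text \<open>
  Write \<open>V\<close> for the weighted \<open>l\<^sub>1\<close> disagreement \<open>\<Sum> a\<^sub>i\<^sub>j \<parallel>x\<^sub>i - x\<^sub>j\<parallel>\<^sub>1 / 2\<close>, which is the \<open>l\<^sub>1\<close> norm of the
  transposed incidence matrix applied to \<open>x\<close>. Every element of the Filippov set has the form
  \<open>H\<^sub>i v\<^sub>i = w\<^sub>i - dg\<^sub>i - \<alpha> \<eta>\<^sub>i\<close> with \<open>w\<^sub>i\<close> the velocity of \<open>z\<^sub>i\<close> and \<open>\<eta>\<close> a subgradient of \<open>V\<close> at \<open>x\<close>. Once all
  \<open>z\<^sub>i\<close> vanish, \<open>dV/dt = \<eta> \<bullet> v\<close>, and a subgradient at a point with \<open>V > 0\<close> satisfies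
  \<open>\<parallel>\<eta>\<parallel>\<^sup>2 \<ge> \<lambda>\<^sub>2(B\<^sup>T B)\<close>; the bound on \<open>\<alpha>\<close> is exactly what makes \<open>dV/dt\<close> at most a negative constant while
  \<open>V > 0\<close>, so consensus is reached in finite time. Since the subgradients of \<open>V\<close> sum to zero,
  \<open>\<Sum> \<nabla>f\<^sub>i(x\<^sub>i, t) - \<Sum> z\<^sub>i\<close> is constant, hence zero. Therefore the consensus value is a critical point of
  \<open>\<Sum> f\<^sub>i\<close>, which is strictly convex.
\<close>

text \<open>Three obstacles shape the proof. The disagreement has kinks where coordinates meet;
  kinks crossed with nonzero speed occur at countably many times only, and wherever its derivative
  exists every subgradient computes it. The maps \<open>\<phi>\<close> may be discontinuous; since
  the same value of \<open>\<phi> i\<close> enters both components of the field, it cancels in an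
  affine function of the joint velocity before any convex hull is taken.

  The threshold for \<open>\<alpha>\<close> comes from Young's inequality in the metric of the
  Hessians. With H w = \<eta> and H e = dg, the form a = \<Sum> w.Hw is at least \<lambda>2 /
  \<theta>max, the form b = \<Sum> e.He is at most N \<kappa>^2 / \<theta>min, and the cross term is
  at most \<beta> a as soon as b \<le> \<beta>^2 a. The ratio of the two bounds is the square of the
  threshold.\<close>

section \<open>Absolutely continuous functions\<close>

text \<open>Transfers absolute continuity from the joint state to quantities computed from it; the
  term in \<open>D\<close> admits explicit dependence on time, as for gradients along the
  trajectory.\<close>

lemma absolutely_continuous_fun_dominated:
  assumes "absolutely_continuous_fun a b y" and "0 \<le> C" "0 \<le> D"
    and dom: "\<And>s t. a \<le> s \<Longrightarrow> s \<le> t \<Longrightarrow> t \<le> b \<Longrightarrow>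
      norm (w t - w s) \<le> C * norm (y t - y s) + D * (t - s)"
  shows "absolutely_continuous_fun a b w"
  unfolding absolutely_continuous_fun_def
proof (intro allI impI)
  fix \<epsilon> :: real assume "0 < \<epsilon>"
  define \<epsilon>' where "\<epsilon>' = \<epsilon> / (2 * (C + 1))"
  have "0 < \<epsilon>'" using \<open>0 < \<epsilon>\<close> \<open>0 \<le> C\<close> by (simp add: \<epsilon>'_def)
  then obtain \<delta> where "0 < \<delta>" and \<delta>: "\<forall>(n::nat) u v. (\<forall>k<n. a \<le> u k \<and> u k \<le> v k \<and> v k \<le> b) \<and>
      (\<forall>k<n. \<forall>l<n. k \<noteq> l \<longrightarrow> {u k<..<v k} \<inter> {u l<..<v l} = {}) \<and>
      (\<Sum>k<n. v k - u k) < \<delta> \<longrightarrow> (\<Sum>k<n. norm (y (v k) - y (u k))) < \<epsilon>'"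
    using assms(1) \<open>0 < \<epsilon>'\<close> unfolding absolutely_continuous_fun_def by blast
  define \<delta>' where "\<delta>' = min \<delta> (\<epsilon> / (2 * (D + 1)))"
  show "\<exists>\<delta>>0. \<forall>(n::nat) u v.
       (\<forall>k<n. a \<le> u k \<and> u k \<le> v k \<and> v k \<le> b) \<and>
       (\<forall>k<n. \<forall>l<n. k \<noteq> l \<longrightarrow> {u k<..<v k} \<inter> {u l<..<v l} = {}) \<and>
       (\<Sum>k<n. v k - u k) < \<delta> \<longrightarrow>
       (\<Sum>k<n. norm (w (v k) - w (u k))) < \<epsilon>"
  proof (intro exI[of _ \<delta>'] conjI allI impI)
    show "0 < \<delta>'" using \<open>0 < \<delta>\<close> \<open>0 < \<epsilon>\<close> \<open>0 \<le> D\<close> by (simp add: \<delta>'_def)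
    fix n :: nat and u v :: "nat \<Rightarrow> real"
    assume *: "(\<forall>k<n. a \<le> u k \<and> u k \<le> v k \<and> v k \<le> b) \<and>
       (\<forall>k<n. \<forall>l<n. k \<noteq> l \<longrightarrow> {u k<..<v k} \<inter> {u l<..<v l} = {}) \<and>
       (\<Sum>k<n. v k - u k) < \<delta>'"
    have len: "(\<Sum>k<n. v k - u k) < \<delta>" "(\<Sum>k<n. v k - u k) < \<epsilon> / (2 * (D + 1))"
      "0 \<le> (\<Sum>k<n. v k - u k)"
      using * by (auto simp: \<delta>'_def intro!: sum_nonneg)
    have "(\<Sum>k<n. norm (w (v k) - w (u k))) \<le>
        (\<Sum>k<n. C * norm (y (v k) - y (u k)) + D * (v k - u k))"
      using * by (intro sum_mono dom) auto
    also have "\<dots> = C * (\<Sum>k<n. norm (y (v k) - y (u k))) + D * (\<Sum>k<n. v k - u k)"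
      by (simp add: sum.distrib sum_distrib_left)
    also have "\<dots> < \<epsilon>"
    proof -
      have "(\<Sum>k<n. norm (y (v k) - y (u k))) < \<epsilon>'" using * len by (intro \<delta>[rule_format]) auto
      then have "C * (\<Sum>k<n. norm (y (v k) - y (u k))) \<le> C * \<epsilon>'"
        using \<open>0 \<le> C\<close> by (intro mult_left_mono) auto
      also have "C * \<epsilon>' < \<epsilon> / 2"
        using \<open>0 < \<epsilon>\<close> \<open>0 \<le> C\<close> by (simp add: \<epsilon>'_def field_simps)
      finally have 1: "C * (\<Sum>k<n. norm (y (v k) - y (u k))) < \<epsilon> / 2" .
      have "D * (\<Sum>k<n. v k - u k) \<le> (D + 1) * (\<Sum>k<n. v k - u k)"
        using len by (intro mult_right_mono) auto
      also have "\<dots> \<le> \<epsilon> / 2"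
        using len(2) \<open>0 \<le> D\<close> by (simp add: field_simps)
      finally show ?thesis using 1 by linarith
    qed
    finally show "(\<Sum>k<n. norm (w (v k) - w (u k))) < \<epsilon>" .
  qed
qed

lemma tagged_partial_division_real_interval:
  fixes a b :: real
  assumes "p tagged_partial_division_of {a..b}" "(x, K) \<in> p"
  obtains u v where "K = {u..v}" "u \<le> x" "x \<le> v" "a \<le> u" "v \<le> b"
proof -
  obtain u v where K: "K = cbox u v"
    using tagged_partial_division_ofD(4)[OF assms] by blast
  have "x \<in> K" "K \<subseteq> {a..b}"
    using tagged_partial_division_ofD[OF assms(1)] assms(2) by blast+
  then show ?thesis using K that[of u v] by auto
qed

text \<open>Cousin's lemma delivers tagged partial divisions, while absolute continuity speaks of
  finite sequences of intervals; an enumeration of \<open>p\<close> translates between the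
  two.\<close>

lemma absolutely_continuous_fun_partial_division:
  fixes w :: "real \<Rightarrow> 'a::real_normed_vector"
  assumes "absolutely_continuous_fun a b w" "0 < \<epsilon>"
  obtains \<delta> where "0 < \<delta>" "\<forall>p. p tagged_partial_division_of {a..b} \<and>
    (\<Sum>(x,K)\<in>p. Sup K - Inf K) < \<delta> \<longrightarrow> (\<Sum>(x,K)\<in>p. norm (w (Sup K) - w (Inf K))) < \<epsilon>"
proof -
  obtain \<delta> where "0 < \<delta>" and \<delta>: "\<forall>(n::nat) u v. (\<forall>k<n. a \<le> u k \<and> u k \<le> v k \<and> v k \<le> b) \<and>
      (\<forall>k<n. \<forall>l<n. k \<noteq> l \<longrightarrow> {u k<..<v k} \<inter> {u l<..<v l} = {}) \<and>
      (\<Sum>k<n. v k - u k) < \<delta> \<longrightarrow> (\<Sum>k<n. norm (w (v k) - w (u k))) < \<epsilon>"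
    using assms unfolding absolutely_continuous_fun_def by blast
  show ?thesis
  proof (rule that[OF \<open>0 < \<delta>\<close>], intro allI impI, elim conjE)
    fix p :: "(real \<times> real set) set" assume p: "p tagged_partial_division_of {a..b}"
      and len: "(\<Sum>(x,K)\<in>p. Sup K - Inf K) < \<delta>"
    obtain h where h: "bij_betw h {..<card p} p"
      using ex_bij_betw_nat_finite[OF tagged_partial_division_ofD(1)[OF p]] atLeast0LessThan by metis
    define u where "u = (\<lambda>k. Inf (snd (h k)))"
    define v where "v = (\<lambda>k. Sup (snd (h k)))"
    have reindex: "(\<Sum>(x,K)\<in>p. F K) = (\<Sum>k<card p. F (snd (h k)))" for F :: "real set \<Rightarrow> real"
      using sum.reindex_bij_betw[OF h, of "\<lambda>(x,K). F K"] by (simp add: case_prod_beta)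
    have int: "snd (h k) = {u k..v k} \<and> a \<le> u k \<and> u k \<le> v k \<and> v k \<le> b" if "k < card p" for k
    proof -
      have "(fst (h k), snd (h k)) \<in> p" using h that by (auto simp: bij_betw_def)
      from tagged_partial_division_real_interval[OF p this]
      obtain u' v' where "snd (h k) = {u'..v'}" "u' \<le> fst (h k)" "fst (h k) \<le> v'" "a \<le> u'" "v' \<le> b"
        by blast
      then show ?thesis by (auto simp: u_def v_def)
    qed
    have "{u k<..<v k} \<inter> {u l<..<v l} = {}" if "k < card p" "l < card p" "k \<noteq> l" for k l
    proof -
      have "h k \<noteq> h l" "h k \<in> p" "h l \<in> p"
        using h that by (auto simp: bij_betw_def inj_on_def)
      then have "interior (snd (h k)) \<inter> interior (snd (h l)) = {}"
        using tagged_partial_division_ofD(5)[OF p, of "fst (h k)" "snd (h k)" "fst (h l)" "snd (h l)"]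
        by auto
      then show ?thesis using int that by (auto simp: interior_atLeastAtMost_real)
    qed
    moreover have "(\<Sum>k<card p. v k - u k) < \<delta>"
      using len reindex[of "\<lambda>K. Sup K - Inf K"] by (simp add: u_def v_def)
    ultimately have "(\<Sum>k<card p. norm (w (v k) - w (u k))) < \<epsilon>"
      using int by (intro \<delta>[rule_format]) auto
    then show "(\<Sum>(x,K)\<in>p. norm (w (Sup K) - w (Inf K))) < \<epsilon>"
      using reindex[of "\<lambda>K. norm (w (Sup K) - w (Inf K))"] by (simp add: u_def v_def)
  qed
qed

lemma tagged_partial_division_length_le_measure:
  fixes a b :: real
  assumes p: "p tagged_partial_division_of {a..b}" and U: "U \<in> lmeasurable"
    and sub: "\<And>x K. (x, K) \<in> p \<Longrightarrow> K \<subseteq> U"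
  shows "(\<Sum>(x,K)\<in>p. Sup K - Inf K) \<le> measure lebesgue U"
proof -
  have div: "p tagged_division_of \<Union>(snd ` p)"
    by (rule tagged_partial_division_of_Union_self[OF p])
  have "(\<Sum>(x,K)\<in>p. Sup K - Inf K) = (\<Sum>(x,K)\<in>p. measure lborel K)"
  proof (intro sum.cong refl, clarify)
    fix x K assume "(x, K) \<in> p"
    then show "Sup K - Inf K = measure lborel K"
      by (rule tagged_partial_division_real_interval[OF p]) auto
  qed
  \<comment> \<open>Two tags can share an interval only if its interior is empty; its content is
    then 0, so forgetting the tags leaves the sum unchanged.\<close>
  also have "\<dots> = sum (measure lborel) (snd ` p)"
    by (rule sum.over_tagged_division_lemma[OF div]) (simp add: content_eq_0_interior)
  also have "\<dots> = (\<Sum>K\<in>snd ` p. measure lebesgue K)"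
  proof (intro sum.cong refl)
    fix K assume "K \<in> snd ` p"
    then obtain c d where "K = cbox c d"
      using division_ofD(4)[OF division_of_tagged_division[OF div]] by blast
    then show "measure lborel K = measure lebesgue K" by (simp add: measure_completion)
  qed
  also have "\<dots> = measure lebesgue (\<Union>(snd ` p))"
    by (rule content_division[OF division_of_tagged_division[OF div]])
  also have "\<dots> \<le> measure lebesgue U"
  proof (rule measure_mono_fmeasurable)
    show "\<Union>(snd ` p) \<subseteq> U" using sub by force
    show "\<Union>(snd ` p) \<in> sets lebesgue"
      using lmeasurable_division[OF division_of_tagged_division[OF div]] by (simp add: fmeasurableD)
  qed (rule U)
  finally show ?thesis .
qed

lemma negligible_open_cover:
  fixes N :: "'a::euclidean_space set"
  assumes "negligible N" "0 < \<epsilon>"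
  obtains U where "open U" "N \<subseteq> U" "U \<in> lmeasurable" "measure lebesgue U < \<epsilon>"
proof -
  obtain U where U: "open U" "N \<subseteq> U" "U - N \<in> lmeasurable" "emeasure lebesgue (U - N) < ennreal \<epsilon>"
    using sets_lebesgue_outer_open[OF negligible_imp_sets[OF assms(1)] assms(2)] by blast
  have N: "N \<in> lmeasurable" "measure lebesgue N = 0"
    using assms(1) by (auto simp: negligible_imp_measurable negligible_imp_measure0)
  have "U = (U - N) \<union> N" using U by auto
  then have "U \<in> lmeasurable" using fmeasurable.Un[OF U(3) N(1)] by simp
  moreover have "measure lebesgue U = measure lebesgue (U - N)"
    using N U(2) assms(1) by (metis (no_types, lifting) measurable_measure_Diff U(3) \<open>U \<in> lmeasurable\<close> diff_zero fmeasurableD)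
  moreover have "measure lebesgue (U - N) < \<epsilon>"
    using U(3,4) assms(2) by (simp add: emeasure_eq_measure2 ennreal_less_iff)
  ultimately show ?thesis using that U by metis
qed

text \<open>The straddle lemma: because \<open>t\<close> lies between \<open>u\<close> and
  \<open>v\<close>, the first-order errors on its two sides add up to at most
  \<open>\<epsilon>\<close> times the length of the interval.\<close>

lemma has_real_derivative_straddle:
  fixes w :: "real \<Rightarrow> real"
  assumes "(w has_real_derivative D) (at t)" "D \<le> m" "0 < \<epsilon>"
  shows "\<exists>d>0. \<forall>u v. u \<le> t \<and> t \<le> v \<and> {u..v} \<subseteq> ball t d \<longrightarrow> w v - w u \<le> (m + \<epsilon>) * (v - u)"
proof -
  have "(w has_derivative (*) D) (at t)"
    using assms(1) by (simp add: has_field_derivative_def)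
  then obtain d where "0 < d" and d: "\<And>y. \<bar>y - t\<bar> < d \<Longrightarrow> \<bar>w y - w t - D * (y - t)\<bar> \<le> \<epsilon> * \<bar>y - t\<bar>"
    using assms(3) unfolding has_derivative_at_alt by (metis real_norm_def)
  have "w v - w u \<le> (m + \<epsilon>) * (v - u)" if "u \<le> t" "t \<le> v" "{u..v} \<subseteq> ball t d" for u v
  proof -
    have "u \<in> ball t d" "v \<in> ball t d" using that by (auto simp del: mem_ball)
    then have "\<bar>w v - w t - D * (v - t)\<bar> \<le> \<epsilon> * \<bar>v - t\<bar>" "\<bar>w u - w t - D * (u - t)\<bar> \<le> \<epsilon> * \<bar>u - t\<bar>"
      by (auto intro!: d simp: dist_real_def)
    then have "w v - w t \<le> D * (v - t) + \<epsilon> * (v - t)" "w t - w u \<le> D * (t - u) + \<epsilon> * (t - u)"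
      using that by (auto simp: algebra_simps abs_le_iff)
    then have "w v - w u \<le> D * (v - u) + \<epsilon> * (v - u)" by (simp add: algebra_simps)
    also have "\<dots> \<le> (m + \<epsilon>) * (v - u)"
      using mult_right_mono[OF assms(2), of "v - u"] that by (simp add: algebra_simps)
    finally show ?thesis .
  qed
  then show ?thesis using \<open>0 < d\<close> by blast
qed

text \<open>Cousin's lemma: on a fine tagged division, the tags off \<open>N\<close> are controlled by the
  derivative, those in \<open>N\<close> by absolute continuity.\<close>

lemma absolutely_continuous_fun_deriv_le:
  fixes w :: "real \<Rightarrow> real"
  assumes ac: "absolutely_continuous_fun a b w" and "a \<le> b" and N: "negligible N"
    and deriv: "\<And>t. a \<le> t \<Longrightarrow> t \<le> b \<Longrightarrow> t \<notin> N \<Longrightarrow> \<exists>D\<le>m. (w has_real_derivative D) (at t)"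
  shows "w b - w a \<le> m * (b - a)"
proof (rule field_le_epsilon)
  fix \<epsilon>' :: real assume "0 < \<epsilon>'"
  \<comment> \<open>One share is the excess slope over the whole length, one the increments over the
    intervals tagged in \<open>N\<close>, one the length that these intervals take away from the
    rest.\<close>
  define \<epsilon> where "\<epsilon> = \<epsilon>' / ((b - a) + 1 + 1)"
  have "0 < \<epsilon>" using \<open>0 < \<epsilon>'\<close> \<open>a \<le> b\<close> by (simp add: \<epsilon>_def)
  obtain \<delta> where "0 < \<delta>" and \<delta>: "\<forall>p. p tagged_partial_division_of {a..b} \<and>
      (\<Sum>(x,K)\<in>p. Sup K - Inf K) < \<delta> \<longrightarrow> (\<Sum>(x,K)\<in>p. norm (w (Sup K) - w (Inf K))) < \<epsilon>"
    using absolutely_continuous_fun_partial_division[OF ac \<open>0 < \<epsilon>\<close>] by blast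
  \<comment> \<open>The second bound matters when \<open>m + \<epsilon>\<close> is negative: leaving
    out the intervals tagged in \<open>N\<close> then raises the estimate, and by at most
    \<open>\<epsilon>\<close>.\<close>
  have "0 < min \<delta> (\<epsilon> / (\<bar>m + \<epsilon>\<bar> + 1))"
    using \<open>0 < \<delta>\<close> \<open>0 < \<epsilon>\<close> by (simp add: add_nonneg_pos)
  then obtain U where U: "open U" "N \<subseteq> U" "U \<in> lmeasurable" "measure lebesgue U < min \<delta> (\<epsilon> / (\<bar>m + \<epsilon>\<bar> + 1))"
    using negligible_open_cover[OF N] by metis
  have "\<forall>t. \<exists>d>0. (t \<in> N \<longrightarrow> ball t d \<subseteq> U) \<and> (t \<in> {a..b} - N \<longrightarrow>
      (\<forall>u v. u \<le> t \<and> t \<le> v \<and> {u..v} \<subseteq> ball t d \<longrightarrow> w v - w u \<le> (m + \<epsilon>) * (v - u)))"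
  proof
    fix t
    show "\<exists>d>0. (t \<in> N \<longrightarrow> ball t d \<subseteq> U) \<and> (t \<in> {a..b} - N \<longrightarrow>
      (\<forall>u v. u \<le> t \<and> t \<le> v \<and> {u..v} \<subseteq> ball t d \<longrightarrow> w v - w u \<le> (m + \<epsilon>) * (v - u)))"
    proof (cases "t \<in> N")
      case True
      then show ?thesis using U(1,2) by (auto simp: open_contains_ball subset_iff)
    next
      case False
      show ?thesis
      proof (cases "t \<in> {a..b}")
        case True
        then obtain D where "D \<le> m" "(w has_real_derivative D) (at t)"
          using deriv[of t] False by auto
        then show ?thesis
          using has_real_derivative_straddle[OF _ _ \<open>0 < \<epsilon>\<close>] False by blast
      qed (use False in \<open>auto intro: exI[of _ 1]\<close>)
    qed
  qed
  then obtain d where d: "\<And>t. 0 < d t" "\<And>t. t \<in> N \<Longrightarrow> ball t (d t) \<subseteq> U"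
      "\<And>t u v. t \<in> {a..b} - N \<Longrightarrow> u \<le> t \<Longrightarrow> t \<le> v \<Longrightarrow> {u..v} \<subseteq> ball t (d t) \<Longrightarrow>
        w v - w u \<le> (m + \<epsilon>) * (v - u)"
    by metis
  obtain p where p: "p tagged_division_of {a..b}" and fine: "(\<lambda>t. ball t (d t)) fine p"
    using fine_division_exists_real[OF gauge_ball_dependent] d(1) by blast
  have pp: "p tagged_partial_division_of {a..b}"
    using p by (simp add: tagged_division_of_def)
  have fin: "finite p" by (rule tagged_partial_division_ofD(1)[OF pp])
  define q where "q = {(x,K)\<in>p. x \<in> N}"
  have "q \<subseteq> p" by (auto simp: q_def)
  have q: "q tagged_partial_division_of {a..b}"
    by (rule tagged_partial_division_subset[OF pp \<open>q \<subseteq> p\<close>])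
  have "K \<subseteq> U" if "(x, K) \<in> q" for x K
    using that fine d(2)[of x] by (force simp: q_def fine_def)
  then have lenq: "(\<Sum>(x,K)\<in>q. Sup K - Inf K) < min \<delta> (\<epsilon> / (\<bar>m + \<epsilon>\<bar> + 1))"
    using tagged_partial_division_length_le_measure[OF q U(3)] U(4) by fastforce
  have lenq0: "0 \<le> (\<Sum>(x,K)\<in>q. Sup K - Inf K)"
  proof (intro sum_nonneg, clarify)
    fix x K assume "(x, K) \<in> q"
    then show "0 \<le> Sup K - Inf K" by (rule tagged_partial_division_real_interval[OF q]) auto
  qed
  have incq: "(\<Sum>(x,K)\<in>q. w (Sup K) - w (Inf K)) \<le> \<epsilon>"
  proof -
    have "(\<Sum>(x,K)\<in>q. w (Sup K) - w (Inf K)) \<le> (\<Sum>(x,K)\<in>q. norm (w (Sup K) - w (Inf K)))"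
      by (intro sum_mono) (auto simp: case_prod_beta)
    then show ?thesis using \<delta>[rule_format, OF conjI, OF q] lenq by linarith
  qed
  have incr: "(\<Sum>(x,K)\<in>p-q. w (Sup K) - w (Inf K)) \<le> (m + \<epsilon>) * (\<Sum>(x,K)\<in>p-q. Sup K - Inf K)"
    unfolding sum_distrib_left
  proof (intro sum_mono, clarify)
    fix x K assume xK: "(x, K) \<in> p" "(x, K) \<notin> q"
    then obtain u v where uv: "K = {u..v}" "u \<le> x" "x \<le> v" "a \<le> u" "v \<le> b"
      using tagged_partial_division_real_interval[OF pp] by blast
    have "x \<in> {a..b} - N" using xK uv by (auto simp: q_def)
    moreover have "{u..v} \<subseteq> ball x (d x)" using fine xK uv by (auto simp: fine_def)
    ultimately show "w (Sup K) - w (Inf K) \<le> (m + \<epsilon>) * (Sup K - Inf K)"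
      using d(3)[of x u v] uv by simp
  qed
  have "w b - w a = (\<Sum>(x,K)\<in>p-q. w (Sup K) - w (Inf K)) + (\<Sum>(x,K)\<in>q. w (Sup K) - w (Inf K))"
    using additive_tagged_division_1[OF \<open>a \<le> b\<close> p, of w] sum.subset_diff[OF \<open>q \<subseteq> p\<close> fin] by metis
  also have "\<dots> \<le> (m + \<epsilon>) * (\<Sum>(x,K)\<in>p-q. Sup K - Inf K) + \<epsilon>"
    using incr incq by linarith
  also have "(\<Sum>(x,K)\<in>p-q. Sup K - Inf K) = (b - a) - (\<Sum>(x,K)\<in>q. Sup K - Inf K)"
    using additive_tagged_division_1[OF \<open>a \<le> b\<close> p, of "\<lambda>x. x"]
      sum.subset_diff[OF \<open>q \<subseteq> p\<close> fin, of "\<lambda>(x,K). Sup K - Inf K"] by linarith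
  also have "(m + \<epsilon>) * ((b - a) - (\<Sum>(x,K)\<in>q. Sup K - Inf K)) + \<epsilon> \<le> (m + \<epsilon>) * (b - a) + \<epsilon> + \<epsilon>"
  proof -
    have "- (m + \<epsilon>) * (\<Sum>(x,K)\<in>q. Sup K - Inf K) \<le> (\<bar>m + \<epsilon>\<bar> + 1) * (\<Sum>(x,K)\<in>q. Sup K - Inf K)"
      by (rule mult_right_mono[OF _ lenq0]) linarith
    also have "\<dots> \<le> \<epsilon>" using lenq by (simp add: field_simps)
    finally show ?thesis by (simp add: algebra_simps)
  qed
  also have "\<dots> = m * (b - a) + \<epsilon>'"
  proof -
    have "\<epsilon> * ((b - a) + 1 + 1) = \<epsilon>'" using \<open>a \<le> b\<close> by (simp add: \<epsilon>_def)
    then show ?thesis by (simp add: algebra_simps)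
  qed
  finally show "w b - w a \<le> m * (b - a) + \<epsilon>'" .
qed

lemma absolutely_continuous_fun_subset:
  assumes "absolutely_continuous_fun a b w" "a \<le> c"
  shows "absolutely_continuous_fun c b w"
  unfolding absolutely_continuous_fun_def
proof (intro allI impI)
  fix \<epsilon> :: real assume "0 < \<epsilon>"
  then obtain \<delta> where "0 < \<delta>" and \<delta>: "\<forall>(n::nat) u v. (\<forall>k<n. a \<le> u k \<and> u k \<le> v k \<and> v k \<le> b) \<and>
      (\<forall>k<n. \<forall>l<n. k \<noteq> l \<longrightarrow> {u k<..<v k} \<inter> {u l<..<v l} = {}) \<and>
      (\<Sum>k<n. v k - u k) < \<delta> \<longrightarrow> (\<Sum>k<n. norm (w (v k) - w (u k))) < \<epsilon>"
    using assms(1) unfolding absolutely_continuous_fun_def by blast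
  show "\<exists>\<delta>>0. \<forall>(n::nat) u v. (\<forall>k<n. c \<le> u k \<and> u k \<le> v k \<and> v k \<le> b) \<and>
      (\<forall>k<n. \<forall>l<n. k \<noteq> l \<longrightarrow> {u k<..<v k} \<inter> {u l<..<v l} = {}) \<and>
      (\<Sum>k<n. v k - u k) < \<delta> \<longrightarrow> (\<Sum>k<n. norm (w (v k) - w (u k))) < \<epsilon>"
  proof (intro exI[of _ \<delta>] conjI allI impI)
    fix n :: nat and u v :: "nat \<Rightarrow> real"
    assume "(\<forall>k<n. c \<le> u k \<and> u k \<le> v k \<and> v k \<le> b) \<and>
      (\<forall>k<n. \<forall>l<n. k \<noteq> l \<longrightarrow> {u k<..<v k} \<inter> {u l<..<v l} = {}) \<and> (\<Sum>k<n. v k - u k) < \<delta>"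
    then show "(\<Sum>k<n. norm (w (v k) - w (u k))) < \<epsilon>"
      using assms(2) by (intro \<delta>[rule_format]) (auto intro: order_trans)
  qed (rule \<open>0 < \<delta>\<close>)
qed

section \<open>Filippov maps\<close>

text \<open>By Tonelli, for almost every shift \<open>s\<close> the set of \<open>x\<close> with \<open>L x + s \<in> S\<close> is null; it is
  a translate of the preimage.\<close>

lemma negligible_linear_preimage:
  fixes L :: "'a::euclidean_space \<Rightarrow> 'b::euclidean_space"
  assumes "linear L" and R: "\<And>s. L (R s) = s" and S: "negligible S"
  shows "negligible (L -` S)"
proof -
  have "S \<in> null_sets (completion lborel)" using S by (simp add: negligible_iff_null_sets)
  \<comment> \<open>A Borel null set around \<open>S\<close> makes the set of pairs in the exchange
    of the two quantifiers measurable in the product.\<close>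
  then obtain S' where S': "S \<subseteq> S'" "S' \<in> null_sets lborel"
    by (meson null_sets_completion_iff2)
  have [measurable]: "S' \<in> sets borel" using S' by auto
  have [measurable]: "L \<in> borel_measurable borel"
    using assms(1) by (intro borel_measurable_continuous_onI linear_continuous_on)
      (simp add: linear_conv_bounded_linear)
  have shift: "AE s in lborel. L x + s \<notin> S'" for x
  proof -
    have "negligible ((+) (- L x) ` S')"
      using S' by (intro negligible_translation) (simp add: negligible_iff_null_sets null_sets_completionI)
    moreover have "{s. L x + s \<in> S'} \<subseteq> (+) (- L x) ` S'"
    proof clarify
      fix s assume "L x + s \<in> S'"
      then show "s \<in> (+) (- L x) ` S'" by (intro image_eqI[of _ _ "L x + s"]) auto
    qed
    ultimately have "AE s in lebesgue. L x + s \<notin> S'"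
      unfolding eventually_ae_filter_negligible by auto
    then show ?thesis by (simp add: AE_completion_iff)
  qed
  have "{p \<in> space (lborel \<Otimes>\<^sub>M lborel). L (fst p) + snd p \<notin> S'} \<in> sets (lborel \<Otimes>\<^sub>M lborel)"
    by measurable
  from lborel_pair.AE_commute[of "\<lambda>x s. L x + s \<notin> S'", OF this] shift
  have "AE s in lborel. AE x in lborel. L x + s \<notin> S'" by simp
  then have "AE s in lebesgue. AE x in lborel. L x + s \<notin> S'" by (rule AE_completion)
  then obtain M where "negligible M" "{s. \<not> (AE x in lborel. L x + s \<notin> S')} \<subseteq> M"
    unfolding eventually_ae_filter_negligible by blast
  moreover from this(1) have "M \<noteq> UNIV" by auto
  ultimately obtain s where "AE x in lborel. L x + s \<notin> S'" by blast
  then have "AE x in lebesgue. L x + s \<notin> S'" by (rule AE_completion)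
  then obtain N where N: "negligible N" "{x. L x + s \<in> S'} \<subseteq> N"
    unfolding eventually_ae_filter_negligible by auto
  have "L -` S \<subseteq> (+) (R s) ` N"
  proof
    fix x assume "x \<in> L -` S"
    then have "L (x - R s) + s \<in> S'"
      using S'(1) R by (auto simp: linear_diff[OF assms(1)])
    then have "x - R s \<in> N" using N(2) by blast
    then show "x \<in> (+) (R s) ` N" by (auto intro: image_eqI[of _ _ "x - R s"])
  qed
  then show ?thesis using N(1) negligible_subset negligible_translation by blast
qed

text \<open>Closed convex sets absorb both the hull and the closure, and the intersection may be
  evaluated at one favourable radius and null set.\<close>

lemma filippov_map_subset:
  assumes "v \<in> filippov_map h t y" "0 < \<delta>" "negligible S" "closed C" "convex C"
    and "\<And>w. w \<in> ball y \<delta> \<Longrightarrow> w \<notin> S \<Longrightarrow> h t w \<in> C"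
  shows "v \<in> C"
proof -
  have "v \<in> closure (convex hull (h t ` (ball y \<delta> - S)))"
    using assms(1-3) by (auto simp: filippov_map_def)
  also have "\<dots> \<subseteq> C"
    using assms by (intro closure_minimal hull_minimal) auto
  finally show ?thesis .
qed

text \<open>A right inverse makes \<open>L\<close> onto, so null sets pull back to null sets; the
  norm bound keeps balls inside balls of the same radius. Hence each set in the intersection for
  \<open>k\<close> contains the image of one in the intersection for \<open>h\<close>.\<close>

lemma filippov_map_linear_image:
  fixes L :: "'a::euclidean_space \<Rightarrow> 'b::euclidean_space"
  assumes "linear L" and R: "\<And>s. L (R s) = s" and le: "\<And>x. norm (L x) \<le> norm x"
    and semi: "\<And>x. L (h t x) = k t (L x)"
    and v: "v \<in> filippov_map h t y"
  shows "L v \<in> filippov_map k t (L y)"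
  unfolding filippov_map_def
proof (intro INT_I)
  fix \<delta> :: real and S :: "'b set" assume "\<delta> \<in> {0<..}" "S \<in> {S. negligible S}"
  then have "negligible (L -` S)" using negligible_linear_preimage[OF assms(1) R] by auto
  then have "v \<in> closure (convex hull (h t ` (ball y \<delta> - L -` S)))"
    using v \<open>\<delta> \<in> {0<..}\<close> by (auto simp: filippov_map_def)
  then have "L v \<in> L ` closure (convex hull (h t ` (ball y \<delta> - L -` S)))" by (rule imageI)
  also have "\<dots> \<subseteq> closure (L ` (convex hull (h t ` (ball y \<delta> - L -` S))))"
    by (rule closure_linear_image_subset[OF assms(1)])
  also have "\<dots> = closure (convex hull (L ` h t ` (ball y \<delta> - L -` S)))"
    by (simp only: convex_hull_linear_image[OF assms(1)])
  finally have "L v \<in> closure (convex hull (L ` h t ` (ball y \<delta> - L -` S)))" .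
  moreover have sub: "L ` h t ` (ball y \<delta> - L -` S) \<subseteq> k t ` (ball (L y) \<delta> - S)"
  proof -
    have "dist (L y) (L x) \<le> dist y x" for x
      using le[of "y - x"] linear_diff[OF assms(1)] by (simp add: dist_norm)
    then have "L x \<in> ball (L y) \<delta>" if "x \<in> ball y \<delta>" for x
      using that by (metis mem_ball order_le_less_trans)
    then show ?thesis using semi by auto
  qed
  ultimately show "L v \<in> closure (convex hull (k t ` (ball (L y) \<delta> - S)))"
    using closure_mono[OF hull_mono[OF sub, of convex]] by blast
qed

text \<open>Meant for the projection to a single auxiliary variable: stability is assumed for
  solutions of its own system, whereas the protocol is solved in the joint space.\<close>

lemma filippov_solution_linear_image:
  fixes L :: "'a::euclidean_space \<Rightarrow> 'b::euclidean_space"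
  assumes "linear L" and "\<And>s. L (R s) = s" and le: "\<And>x. norm (L x) \<le> norm x"
    and "\<And>t x. L (h t x) = k t (L x)" and sol: "filippov_solution h y"
  shows "filippov_solution k (\<lambda>t. L (y t))"
  unfolding filippov_solution_def
proof (intro conjI allI impI)
  fix b :: real assume "0 \<le> b"
  show "absolutely_continuous_fun 0 b (\<lambda>t. L (y t))"
  proof (rule absolutely_continuous_fun_dominated[of 0 b y 1 0])
    show "absolutely_continuous_fun 0 b y"
      using sol \<open>0 \<le> b\<close> by (simp add: filippov_solution_def)
    show "norm (L (y t) - L (y s)) \<le> 1 * norm (y t - y s) + 0 * (t - s)" for s t
      using le[of "y t - y s"] linear_diff[OF assms(1), of "y t" "y s"] by simp
  qed auto
next
  have "AE t in lebesgue. 0 \<le> t \<longrightarrow> (\<exists>v\<in>filippov_map h t (y t). (y has_vector_derivative v) (at t))"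
    using sol by (simp add: filippov_solution_def)
  then show "AE t in lebesgue. 0 \<le> t \<longrightarrow>
      (\<exists>v\<in>filippov_map k t (L (y t)). ((\<lambda>t. L (y t)) has_vector_derivative v) (at t))"
  proof eventually_elim
    case (elim t)
    show ?case
    proof
      assume "0 \<le> t"
      then obtain v where v: "v \<in> filippov_map h t (y t)" "(y has_vector_derivative v) (at t)"
        using elim by blast
      have "((\<lambda>t. L (y t)) has_vector_derivative L v) (at t)"
        using assms(1) by (intro bounded_linear.has_vector_derivative[OF _ v(2)])
          (simp add: linear_conv_bounded_linear)
      then show "\<exists>v\<in>filippov_map k t (L (y t)). ((\<lambda>t. L (y t)) has_vector_derivative v) (at t)"
        by (rule bexI[OF _ filippov_map_linear_image[of L R h t k, OF assms(1-4) v(1)]])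
    qed
  qed
qed

section \<open>Graph disagreement and the incidence matrix\<close>

lemma quadratic_nonneg_imp_linear_eq_0:
  fixes a b :: real
  assumes "\<And>t. 0 \<le> 2 * t * a + t\<^sup>2 * b"
  shows "a = 0"
proof (rule ccontr)
  assume "a \<noteq> 0"
  \<comment> \<open>For any positive \<open>c\<close> above \<open>b\<close>, the quadratic is
    negative at \<open>t = - a / c\<close>.\<close>
  define c where "c = \<bar>b\<bar> + 1"
  have "0 < c" "b < c" by (auto simp: c_def)
  have "0 \<le> 2 * (- a / c) * a + (- a / c)\<^sup>2 * b" by (rule assms)
  also have "\<dots> = (a\<^sup>2 / c) * (b / c - 2)"
    using \<open>0 < c\<close> by (simp add: field_simps power2_eq_square)
  also have "\<dots> < 0"
  proof -
    have "0 < a\<^sup>2 / c" using \<open>a \<noteq> 0\<close> \<open>0 < c\<close> by simp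
    moreover have "b / c < 1" using \<open>0 < c\<close> \<open>b < c\<close> by simp
    ultimately show ?thesis by (intro mult_pos_neg) auto
  qed
  finally show False by simp
qed

lemma norm_add_scaleR_power2:
  fixes x y :: "'a::real_inner"
  shows "(norm (x + t *\<^sub>R y))\<^sup>2 = (norm x)\<^sup>2 + 2 * t * (x \<bullet> y) + t\<^sup>2 * (norm y)\<^sup>2"
  by (simp add: power2_norm_eq_inner inner_add_left inner_add_right inner_commute[of y x])
    (simp add: power2_eq_square algebra_simps)

text \<open>The minimum of the Rayleigh quotient of \<open>B ** transpose B\<close> on the range of \<open>B\<close> is the smallest
  positive eigenvalue of \<open>transpose B ** B\<close>.\<close>

lemma lambda2_gram:
  fixes B :: "real^'m^'k"
  assumes "B \<noteq> 0"
  shows lambda2_gram_pos: "0 < lambda2 (transpose B ** B)"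
    and lambda2_gram_le: "p \<in> range ((*v) B) \<Longrightarrow>
      lambda2 (transpose B ** B) * (norm p)\<^sup>2 \<le> (norm (transpose B *v p))\<^sup>2"
proof -
  let ?R = "range ((*v) B)"
  have sub: "subspace ?R"
    by (intro linear_subspace_image matrix_vector_mul_linear subspace_UNIV)
  have adj: "p \<bullet> (B *v x) = (transpose B *v p) \<bullet> x" for p x
    by (metis dot_lmul_matrix transpose_matrix_vector)
  obtain x0 where x0: "B *v x0 \<noteq> 0"
    using assms by (metis matrix_eq matrix_vector_mult_0)
  let ?S = "?R \<inter> sphere 0 1"
  have "compact ?S" using closed_subspace[OF sub] by (intro closed_Int_compact) auto
  moreover have "(B *v x0) /\<^sub>R norm (B *v x0) \<in> ?S"
    using x0 subspace_scale[OF sub, of "B *v x0"] by auto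
  moreover have "continuous_on ?S (\<lambda>p. (norm (transpose B *v p))\<^sup>2)"
    by (intro continuous_intros)
  ultimately obtain u where u: "u \<in> ?S"
    and min: "\<And>p. p \<in> ?S \<Longrightarrow> (norm (transpose B *v u))\<^sup>2 \<le> (norm (transpose B *v p))\<^sup>2"
    using continuous_attains_inf[of ?S "\<lambda>p. (norm (transpose B *v p))\<^sup>2"] by blast
  define \<mu> where "\<mu> = (norm (transpose B *v u))\<^sup>2"
  have le: "\<mu> * (norm p)\<^sup>2 \<le> (norm (transpose B *v p))\<^sup>2" if "p \<in> ?R" for p
  proof (cases "p = 0")
    case False
    have "p /\<^sub>R norm p \<in> ?S" using that False subspace_scale[OF sub] by auto
    then have "\<mu> \<le> (norm (transpose B *v (p /\<^sub>R norm p)))\<^sup>2" unfolding \<mu>_def by (rule min)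
    also have "\<dots> = (norm (transpose B *v p))\<^sup>2 / (norm p)\<^sup>2"
      by (simp add: matrix_vector_mult_scaleR power_mult_distrib power_divide divide_inverse power_inverse mult.commute)
    finally show ?thesis using False by (simp add: field_simps)
  qed simp
  have uR: "u \<in> ?R" and nu: "norm u = 1" using u by auto
  have stationary: "(transpose B *v u) \<bullet> (transpose B *v p) - \<mu> * (u \<bullet> p) = 0" if "p \<in> ?R" for p
  proof (rule quadratic_nonneg_imp_linear_eq_0)
    fix t :: real
    have "u + t *\<^sub>R p \<in> ?R"
      using sub uR that by (intro subspace_add subspace_scale)
    from le[OF this]
    have "\<mu> * (1 + 2 * t * (u \<bullet> p) + t\<^sup>2 * (norm p)\<^sup>2) \<le>
        \<mu> + 2 * t * ((transpose B *v u) \<bullet> (transpose B *v p)) + t\<^sup>2 * (norm (transpose B *v p))\<^sup>2"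
      unfolding matrix_vector_right_distrib matrix_vector_mult_scaleR norm_add_scaleR_power2 nu
      by (simp add: \<mu>_def)
    then show "0 \<le> 2 * t * ((transpose B *v u) \<bullet> (transpose B *v p) - \<mu> * (u \<bullet> p)) +
        t\<^sup>2 * ((norm (transpose B *v p))\<^sup>2 - \<mu> * (norm p)\<^sup>2)"
      by (simp add: algebra_simps)
  qed
  \<comment> \<open>The residual lies in the range of \<open>B\<close>, so it is itself an
    admissible direction in \<open>stationary\<close>, which makes it orthogonal to itself.\<close>
  have eig: "B *v (transpose B *v u) = \<mu> *\<^sub>R u"
  proof -
    define w where "w = B *v (transpose B *v u) - \<mu> *\<^sub>R u"
    have "w \<in> ?R" unfolding w_def using sub uR by (intro subspace_diff subspace_scale) auto
    have "w \<bullet> w = w \<bullet> (B *v (transpose B *v u)) - \<mu> * (w \<bullet> u)"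
      by (subst (2) w_def) (simp only: inner_diff_right inner_scaleR_right)
    also have "\<dots> = 0"
      using stationary[OF \<open>w \<in> ?R\<close>] unfolding adj by (simp only: inner_commute)
    finally show ?thesis by (simp add: w_def)
  qed
  \<comment> \<open>Otherwise \<open>u\<close> would lie both in the range of \<open>B\<close> and
    in the kernel of its transpose, which are orthogonal.\<close>
  have "\<mu> \<noteq> 0"
  proof
    assume "\<mu> = 0"
    then have "transpose B *v u = 0" by (simp add: \<mu>_def)
    moreover obtain x where "u = B *v x" using uR by auto
    ultimately have "u \<bullet> u = 0" using adj[of u x] by simp
    then show False using nu by simp
  qed
  then have "0 < \<mu>" by (simp add: \<mu>_def)
  have "transpose B *v u \<noteq> 0" using \<open>\<mu> \<noteq> 0\<close> by (auto simp: \<mu>_def)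
  moreover have "(transpose B ** B) *v (transpose B *v u) = \<mu> *\<^sub>R (transpose B *v u)"
    by (simp only: eig matrix_vector_mult_scaleR matrix_vector_mul_assoc[symmetric])
  ultimately have ev: "real_eigenvalue (transpose B ** B) \<mu>"
    unfolding real_eigenvalue_def by blast
  have "lambda2 (transpose B ** B) = \<mu>"
    unfolding lambda2_def
  proof (rule Least_equality)
    \<comment> \<open>For an eigenvector \<open>v\<close> the Rayleigh bound at
      \<open>B *v v\<close> reads \<open>\<mu> * l \<le> l * l\<close>, up to the factor
      \<open>(norm v)\<^sup>2\<close>.\<close>
    fix l assume l: "0 < l \<and> real_eigenvalue (transpose B ** B) l"
    then obtain v where v: "v \<noteq> 0" "(transpose B ** B) *v v = l *\<^sub>R v"
      by (auto simp: real_eigenvalue_def)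
    then have Bv: "transpose B *v (B *v v) = l *\<^sub>R v" by (simp add: matrix_vector_mul_assoc)
    then have "(norm (B *v v))\<^sup>2 = l * (norm v)\<^sup>2"
      by (simp add: power2_norm_eq_inner adj)
    then have "\<mu> * (l * (norm v)\<^sup>2) \<le> l * (l * (norm v)\<^sup>2)"
      using le[of "B *v v"] l unfolding Bv by (simp add: power_mult_distrib power2_eq_square mult_ac)
    then show "\<mu> \<le> l" using l v(1) by (simp add: mult_le_cancel_right)
  qed (use \<open>0 < \<mu>\<close> ev in auto)
  then show "0 < lambda2 (transpose B ** B)" and "p \<in> range ((*v) B) \<Longrightarrow>
      lambda2 (transpose B ** B) * (norm p)\<^sup>2 \<le> (norm (transpose B *v p))\<^sup>2"
    using \<open>0 < \<mu>\<close> le by auto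
qed

text \<open>The isometry from tuples of vectors to the space on which Kronecker products act; it
  lets the incidence matrix be applied to a joint state.\<close>

definition flatten :: "(real^'n)^'v \<Rightarrow> real^('v::finite \<times> 'n::finite)" where
  "flatten Y = (\<chi> p. Y $ fst p $ snd p)"

lemma inner_flatten: "flatten Y \<bullet> flatten W = Y \<bullet> W"
proof -
  have "flatten Y \<bullet> flatten W = (\<Sum>p\<in>UNIV \<times> UNIV. Y $ fst p $ snd p * W $ fst p $ snd p)"
    by (simp add: inner_vec_def flatten_def)
  also have "\<dots> = Y \<bullet> W"
    unfolding inner_vec_def by (subst sum.cartesian_product') simp
  finally show ?thesis .
qed

lemma norm_flatten: "norm (flatten Y) = norm Y"
  by (simp add: norm_eq_sqrt_inner inner_flatten)

lemma surj_flatten: "surj flatten"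
proof (rule surjI)
  show "flatten (\<chi> i. \<chi> c. y $ (i, c)) = y" for y :: "real^('v::finite \<times> 'n::finite)"
    by (simp add: flatten_def vec_eq_iff)
qed

definition disagreement :: "real^'v^'v \<Rightarrow> (real^'n)^'v \<Rightarrow> real" where
  "disagreement A Y = (\<Sum>i\<in>UNIV. \<Sum>j\<in>UNIV. A $ i $ j * (\<Sum>c\<in>UNIV. \<bar>Y $ i $ c - Y $ j $ c\<bar>)) / 2"

text \<open>A particular subgradient of the disagreement at \<open>Y\<close>: the one that takes the
  value 0 wherever two coordinates agree.\<close>

definition coupling :: "real^'v^'v \<Rightarrow> (real^'n)^'v \<Rightarrow> (real^'n)^'v" where
  "coupling A Y = (\<chi> i. \<Sum>j\<in>UNIV. A $ i $ j *\<^sub>R sgn_vec (Y $ i - Y $ j))"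

locale weighted_graph =
  fixes E :: "('v::{finite,linorder} \<times> 'v) set" and A :: "real^'v::{finite,linorder}^'v::{finite,linorder}"
  assumes graph: "undirected_weighted_graph E A"
begin

lemma weight_sym: "A $ i $ j = A $ j $ i"
  using graph unfolding undirected_weighted_graph_def transpose_def vec_eq_iff by simp

lemma weight_nonneg: "0 \<le> A $ i $ j"
  using graph unfolding undirected_weighted_graph_def by simp

lemma weight_pos_iff: "0 < A $ i $ j \<longleftrightarrow> (i, j) \<in> E"
  using graph weight_sym unfolding undirected_weighted_graph_def by metis

lemma edge_sym: "(i, j) \<in> E \<longleftrightarrow> (j, i) \<in> E"
  using weight_pos_iff weight_sym by metis

lemma edge_irrefl: "(i, i) \<notin> E"
  using graph unfolding undirected_weighted_graph_def by (metis less_irrefl)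

text \<open>Summation by parts on the graph: exchanging \<open>i\<close> and \<open>j\<close>
  negates the sign vector and keeps the weight, so half of the sum can be moved to the other
  endpoint.\<close>

lemma coupling_inner:
  "coupling A Y \<bullet> W = (\<Sum>i\<in>UNIV. \<Sum>j\<in>UNIV. A $ i $ j * (sgn_vec (Y $ i - Y $ j) \<bullet> (W $ i - W $ j))) / 2"
proof -
  let ?s = "\<lambda>i j. sgn_vec (Y $ i - Y $ j)"
  have neg: "?s j i = - ?s i j" for i j
    by (simp add: sgn_vec_def vec_eq_iff sgn_minus flip: sgn_minus)
  have "coupling A Y \<bullet> W = (\<Sum>i\<in>UNIV. \<Sum>j\<in>UNIV. A $ i $ j * (?s i j \<bullet> W $ i))"
    by (simp add: coupling_def inner_vec_def[of _ W] inner_sum_left)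
  moreover have "(\<Sum>i\<in>UNIV. \<Sum>j\<in>UNIV. A $ i $ j * (?s i j \<bullet> W $ i)) =
      (\<Sum>i\<in>UNIV. \<Sum>j\<in>UNIV. - (A $ i $ j * (?s i j \<bullet> W $ j)))"
  proof (subst sum.swap, intro sum.cong refl)
    fix i j
    show "A $ j $ i * (?s j i \<bullet> W $ j) = - (A $ i $ j * (?s i j \<bullet> W $ j))"
      unfolding neg[of i j] weight_sym[of j i] by simp
  qed
  ultimately have "2 * (coupling A Y \<bullet> W) =
     (\<Sum>i\<in>UNIV. \<Sum>j\<in>UNIV. A $ i $ j * (?s i j \<bullet> W $ i)) + (\<Sum>i\<in>UNIV. \<Sum>j\<in>UNIV. - (A $ i $ j * (?s i j \<bullet> W $ j)))"
    by simp
  also have "\<dots> = (\<Sum>i\<in>UNIV. \<Sum>j\<in>UNIV. A $ i $ j * (?s i j \<bullet> (W $ i - W $ j)))"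
    unfolding sum.distrib[symmetric] by (simp add: inner_diff_right algebra_simps)
  finally show ?thesis by simp
qed

text \<open>For a seminorm, a subgradient at \<open>Y\<close> is a vector whose pairing is dominated
  by the seminorm everywhere and attains it at \<open>Y\<close>. This is the domination;
  \<open>coupling_inner_self\<close> is the attainment.\<close>

lemma coupling_inner_le: "coupling A Y \<bullet> W \<le> disagreement A W"
proof -
  have "sgn_vec (Y $ i - Y $ j) \<bullet> (W $ i - W $ j) \<le> (\<Sum>c\<in>UNIV. \<bar>W $ i $ c - W $ j $ c\<bar>)" for i j
    unfolding inner_vec_def by (intro sum_mono) (auto simp: sgn_vec_def sgn_if)
  then show ?thesis
    unfolding coupling_inner disagreement_def
    by (intro divide_right_mono sum_mono mult_left_mono weight_nonneg) auto
qed

lemma coupling_inner_self: "coupling A Y \<bullet> Y = disagreement A Y"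
proof -
  have "sgn_vec (Y $ i - Y $ j) \<bullet> (Y $ i - Y $ j) = (\<Sum>c\<in>UNIV. \<bar>Y $ i $ c - Y $ j $ c\<bar>)" for i j
    unfolding inner_vec_def by (simp add: sgn_vec_def abs_sgn mult.commute)
  then show ?thesis by (simp only: coupling_inner disagreement_def)
qed

lemma disagreement_nonneg: "0 \<le> disagreement A Y"
  unfolding disagreement_def
  by (intro divide_nonneg_nonneg sum_nonneg mult_nonneg_nonneg weight_nonneg) auto

lemma disagreement_add: "disagreement A (Y + W) \<le> disagreement A Y + disagreement A W"
proof -
  have "(\<Sum>c\<in>UNIV. \<bar>(Y + W) $ i $ c - (Y + W) $ j $ c\<bar>) \<le>
    (\<Sum>c\<in>UNIV. \<bar>Y $ i $ c - Y $ j $ c\<bar>) + (\<Sum>c\<in>UNIV. \<bar>W $ i $ c - W $ j $ c\<bar>)" for i j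
    unfolding sum.distrib[symmetric] by (intro sum_mono) auto
  then have "(\<Sum>i\<in>UNIV. \<Sum>j\<in>UNIV. A $ i $ j * (\<Sum>c\<in>UNIV. \<bar>(Y + W) $ i $ c - (Y + W) $ j $ c\<bar>)) \<le>
    (\<Sum>i\<in>UNIV. \<Sum>j\<in>UNIV. A $ i $ j * ((\<Sum>c\<in>UNIV. \<bar>Y $ i $ c - Y $ j $ c\<bar>) + (\<Sum>c\<in>UNIV. \<bar>W $ i $ c - W $ j $ c\<bar>)))"
    by (intro sum_mono mult_left_mono weight_nonneg) auto
  then show ?thesis by (simp add: disagreement_def sum.distrib distrib_left)
qed

lemma disagreement_const: "disagreement A (\<chi> i. x) = 0"
  by (simp add: disagreement_def)

lemma disagreement_minus_commute: "disagreement A (Y - W) = disagreement A (W - Y)"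
proof -
  have "\<bar>(Y - W) $ i $ c - (Y - W) $ j $ c\<bar> = \<bar>(W - Y) $ i $ c - (W - Y) $ j $ c\<bar>" for i j c by simp
  then show ?thesis by (simp only: disagreement_def)
qed

lemma disagreement_eq_0_edge:
  assumes "disagreement A Y = 0" "(i, j) \<in> E"
  shows "Y $ i = Y $ j"
proof -
  let ?d = "\<lambda>i j. A $ i $ j * (\<Sum>c\<in>UNIV. \<bar>Y $ i $ c - Y $ j $ c\<bar>)"
  have nn: "0 \<le> ?d i j" for i j by (intro mult_nonneg_nonneg weight_nonneg sum_nonneg) auto
  have "(\<Sum>i\<in>UNIV. \<Sum>j\<in>UNIV. ?d i j) = 0" using assms(1) by (simp add: disagreement_def)
  then have "?d i j = 0"
    using nn by (simp add: sum_nonneg_eq_0_iff sum_nonneg)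
  moreover have "A $ i $ j > 0" using assms(2) weight_pos_iff by blast
  ultimately show ?thesis by (simp add: sum_nonneg_eq_0_iff vec_eq_iff)
qed

lemma disagreement_eq_0_connected:
  assumes "disagreement A Y = 0" "connected_graph E"
  shows "Y $ i = Y $ j"
proof -
  have "(i, j) \<in> E\<^sup>*" using assms(2) by (simp add: connected_graph_def)
  then show ?thesis
    by induction (use disagreement_eq_0_edge[OF assms(1)] in auto)
qed

section \<open>Undirected edges and the columns of the incidence matrix\<close>

lemma edge_eq_Min_Max:
  assumes "S \<in> undirected_edges E"
  shows "S = {Min S, Max S}" "Min S < Max S" "(Min S, Max S) \<in> E"
proof -
  obtain i j where S: "S = {i, j}" "(i, j) \<in> E" using assms by (auto simp: undirected_edges_def)
  then have "i \<noteq> j" using edge_irrefl by auto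
  then show "S = {Min S, Max S}" "Min S < Max S" "(Min S, Max S) \<in> E"
    using S edge_sym by (auto simp: min_def max_def)
qed

text \<open>The edges split into increasing pairs, which the columns enumerate, and their mirror
  images, on which a symmetric \<open>F\<close> takes the same values; this is the factor 2.\<close>

lemma sum_edges:
  fixes F :: "'v \<Rightarrow> 'v \<Rightarrow> real" and e :: "'m::finite \<Rightarrow> 'v set"
  assumes e: "bij_betw e UNIV (undirected_edges E)"
    and sym: "\<And>i j. F i j = F j i" and off: "\<And>i j. (i, j) \<notin> E \<Longrightarrow> F i j = 0"
  shows "(\<Sum>i\<in>UNIV. \<Sum>j\<in>UNIV. F i j) = 2 * (\<Sum>k\<in>UNIV. F (Min (e k)) (Max (e k)))"
proof -
  define L where "L = {(i, j). (i, j) \<in> E \<and> i < j}"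
  define U where "U = {(i, j). (i, j) \<in> E \<and> j < i}"
  have ek: "e k \<in> undirected_edges E" for k using e by (auto simp: bij_betw_def)
  have "bij_betw (\<lambda>k. (Min (e k), Max (e k))) UNIV L"
    unfolding bij_betw_def
  proof
    show "inj (\<lambda>k. (Min (e k), Max (e k)))"
    proof (rule injI)
      fix k l assume "(Min (e k), Max (e k)) = (Min (e l), Max (e l))"
      then have "e k = e l" using edge_eq_Min_Max(1)[OF ek] by (metis prod.inject)
      then show "k = l" using e by (auto simp: bij_betw_def dest: injD)
    qed
    show "range (\<lambda>k. (Min (e k), Max (e k))) = L"
    proof
      show "range (\<lambda>k. (Min (e k), Max (e k))) \<subseteq> L"
        using edge_eq_Min_Max[OF ek] by (auto simp: L_def)
      show "L \<subseteq> range (\<lambda>k. (Min (e k), Max (e k)))"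
      proof clarify
        fix i j assume "(i, j) \<in> L"
        then have ij: "(i, j) \<in> E" "i < j" by (auto simp: L_def)
        then have "{i, j} \<in> undirected_edges E" by (auto simp: undirected_edges_def)
        then obtain k where "e k = {i, j}" using e unfolding bij_betw_def by (metis imageE)
        then have "(i, j) = (Min (e k), Max (e k))" using ij by (auto simp: min_def max_def)
        then show "(i, j) \<in> range (\<lambda>k. (Min (e k), Max (e k)))" by blast
      qed
    qed
  qed
  then have L: "(\<Sum>k\<in>UNIV. F (Min (e k)) (Max (e k))) = (\<Sum>(i,j)\<in>L. F i j)"
    using sum.reindex_bij_betw[of _ UNIV L "\<lambda>(i,j). F i j"] by force
  have "bij_betw prod.swap L U"
    by (rule bij_betwI[of _ _ _ prod.swap]) (auto simp: L_def U_def edge_sym)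
  then have U: "(\<Sum>(i,j)\<in>U. F i j) = (\<Sum>(i,j)\<in>L. F i j)"
    using sum.reindex_bij_betw[of prod.swap L U "\<lambda>(i,j). F i j"] sym
    by (simp add: case_prod_beta)
  have "(\<Sum>i\<in>UNIV. \<Sum>j\<in>UNIV. F i j) = (\<Sum>(i,j)\<in>UNIV. F i j)"
    by (simp add: sum.cartesian_product)
  also have "\<dots> = (\<Sum>(i,j)\<in>L \<union> U. F i j)"
  proof (rule sum.mono_neutral_right)
    show "\<forall>p\<in>UNIV - (L \<union> U). (case p of (i, j) \<Rightarrow> F i j) = 0"
      using off edge_irrefl by (auto simp: L_def U_def) (metis linorder_less_linear)
  qed auto
  also have "\<dots> = (\<Sum>(i,j)\<in>L. F i j) + (\<Sum>(i,j)\<in>U. F i j)"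
    by (rule sum.union_disjoint) (auto simp: L_def U_def)
  finally show ?thesis using L U by simp
qed

text \<open>Column \<open>k\<close> is supported on the two ends of its edge, and the identity
  factor selects coordinate \<open>c\<close>: the transpose acts as the weighted difference operator
  along edges.\<close>

lemma incidence_transpose_mult:
  fixes e :: "'m::finite \<Rightarrow> 'v set" and Y :: "(real^'n)^'v::{finite,linorder}"
  assumes e: "bij_betw e UNIV (undirected_edges E)"
  shows "(transpose (kronecker (weighted_incidence A e) (mat 1 :: real^'n^'n)) *v flatten Y) $ (k, c) =
    A $ Min (e k) $ Max (e k) * (Y $ Min (e k) $ c - Y $ Max (e k) $ c)"
proof -
  have "e k \<in> undirected_edges E" using e by (auto simp: bij_betw_def)
  then have ne: "Min (e k) \<noteq> Max (e k)" using edge_eq_Min_Max(2) by fastforce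
  let ?W = "weighted_incidence A e"
  have "(transpose (kronecker ?W (mat 1 :: real^'n^'n)) *v flatten Y) $ (k, c) =
    (\<Sum>p\<in>UNIV \<times> UNIV. ?W $ fst p $ k * (mat 1 :: real^'n^'n) $ snd p $ c * Y $ fst p $ snd p)"
    by (simp add: matrix_vector_mult_def transpose_def kronecker_def flatten_def)
  also have "\<dots> = (\<Sum>i\<in>UNIV. \<Sum>d\<in>UNIV. ?W $ i $ k * (mat 1 :: real^'n^'n) $ d $ c * Y $ i $ d)"
    by (subst sum.cartesian_product') simp
  also have "\<dots> = (\<Sum>i\<in>UNIV. ?W $ i $ k * Y $ i $ c)"
  proof (intro sum.cong refl)
    fix i
    have "(\<Sum>d\<in>UNIV. ?W $ i $ k * (mat 1 :: real^'n^'n) $ d $ c * Y $ i $ d) =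
      (\<Sum>d\<in>UNIV. if d = c then ?W $ i $ k * Y $ i $ d else 0)"
      by (intro sum.cong refl) (simp add: mat_def)
    then show "(\<Sum>d\<in>UNIV. ?W $ i $ k * (mat 1 :: real^'n^'n) $ d $ c * Y $ i $ d) = ?W $ i $ k * Y $ i $ c"
      by simp
  qed
  also have "\<dots> = (\<Sum>i\<in>{Min (e k), Max (e k)}. ?W $ i $ k * Y $ i $ c)"
    by (rule sum.mono_neutral_right) (auto simp: weighted_incidence_def)
  also have "\<dots> = A $ Min (e k) $ Max (e k) * (Y $ Min (e k) $ c - Y $ Max (e k) $ c)"
    using ne by (simp add: weighted_incidence_def algebra_simps)
  finally show ?thesis .
qed

lemma disagreement_eq_l1_incidence:
  fixes e :: "'m::finite \<Rightarrow> 'v set" and Y :: "(real^'n)^'v::{finite,linorder}"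
  assumes e: "bij_betw e UNIV (undirected_edges E)"
  shows "disagreement A Y =
    (\<Sum>p\<in>UNIV. \<bar>(transpose (kronecker (weighted_incidence A e) (mat 1 :: real^'n^'n)) *v flatten Y) $ p\<bar>)"
proof -
  let ?F = "\<lambda>i j. A $ i $ j * (\<Sum>c\<in>UNIV. \<bar>Y $ i $ c - Y $ j $ c\<bar>)"
  have "A $ i $ j = 0" if "(i, j) \<notin> E" for i j
    using that weight_pos_iff[of i j] weight_nonneg[of i j] by linarith
  then have "disagreement A Y = (\<Sum>k\<in>UNIV. ?F (Min (e k)) (Max (e k)))"
    using sum_edges[OF e, of ?F] weight_sym by (simp add: disagreement_def abs_minus_commute)
  also have "\<dots> = (\<Sum>k\<in>UNIV. \<Sum>c\<in>UNIV.
      \<bar>(transpose (kronecker (weighted_incidence A e) (mat 1 :: real^'n^'n)) *v flatten Y) $ (k, c)\<bar>)"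
    unfolding incidence_transpose_mult[OF e]
    by (simp add: abs_mult weight_nonneg sum_distrib_left)
  finally show ?thesis by (simp add: sum.cartesian_product case_prod_beta flip: UNIV_Times_UNIV)
qed

text \<open>The index type of the columns is nonempty, so there is an edge, and its positive weight
  is an entry. A nonzero matrix is what guarantees that a positive eigenvalue exists and
  \<open>lambda2\<close> is a true minimum.\<close>

lemma kronecker_incidence_neq_0:
  fixes e :: "'m::finite \<Rightarrow> 'v set"
  assumes e: "bij_betw e UNIV (undirected_edges E)"
  shows "kronecker (weighted_incidence A e) (mat 1 :: real^'n^'n) \<noteq> 0"
proof -
  fix k
  have "e k \<in> undirected_edges E" using e by (auto simp: bij_betw_def)
  then have "0 < A $ Min (e k) $ Max (e k)"
    using edge_eq_Min_Max(3) weight_pos_iff by blast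
  then have "kronecker (weighted_incidence A e) (mat 1 :: real^'n^'n) $ (Min (e k), c) $ (k, c) \<noteq> 0" for c
    by (simp add: kronecker_def weighted_incidence_def mat_def)
  then show ?thesis by (metis zero_index)
qed

text \<open>The component of \<open>x\<close> orthogonal to the range of \<open>B\<close> is invisible to the disagreement, so the
  two hypotheses bound \<open>\<eta>\<close> from below along the component inside the range.\<close>

lemma lambda2_le_norm_subgradient:
  fixes e :: "'m::finite \<Rightarrow> 'v set" and \<eta> X :: "(real^'n)^'v::{finite,linorder}"
  defines "B \<equiv> kronecker (weighted_incidence A e) (mat 1 :: real^'n^'n)"
  assumes e: "bij_betw e UNIV (undirected_edges E)"
    and le: "\<And>Y. \<eta> \<bullet> Y \<le> disagreement A Y" and ge: "disagreement A X \<le> \<eta> \<bullet> X"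
    and pos: "0 < disagreement A X"
  shows "lambda2 (transpose B ** B) \<le> (norm \<eta>)\<^sup>2"
proof -
  let ?R = "range ((*v) B)" and ?l = "lambda2 (transpose B ** B)"
  have B0: "B \<noteq> 0" unfolding B_def by (rule kronecker_incidence_neq_0[OF e])
  have "subspace ?R"
    by (intro linear_subspace_image matrix_vector_mul_linear subspace_UNIV)
  then obtain p q where p: "p \<in> ?R" and q: "\<And>w. w \<in> ?R \<Longrightarrow> orthogonal q w" and pq: "flatten X = p + q"
    using orthogonal_subspace_decomp_exists[of ?R "flatten X"] by (metis span_eq_iff)
  have "(transpose B *v q) \<bullet> z = 0" for z
    using q[of "B *v z"] by (simp add: orthogonal_def dot_lmul_matrix)
  then have Bq: "transpose B *v q = 0" by (metis inner_eq_zero_iff)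
  obtain Q where Q: "q = flatten Q" using surj_flatten by blast
  have "disagreement A Q = (\<Sum>p\<in>UNIV. \<bar>(transpose B *v q) $ p\<bar>)"
    unfolding B_def Q by (rule disagreement_eq_l1_incidence[OF e])
  then have "disagreement A Q = 0" unfolding Bq by simp
  then have "flatten \<eta> \<bullet> q \<le> 0" using le[of Q] by (simp add: Q inner_flatten)
  moreover have "\<eta> \<bullet> X = flatten \<eta> \<bullet> p + flatten \<eta> \<bullet> q"
    by (simp add: pq inner_add_right flip: inner_flatten)
  ultimately have 1: "disagreement A X \<le> flatten \<eta> \<bullet> p" using ge by linarith
  then have "p \<noteq> 0" using pos by auto
  \<comment> \<open>The chain runs from the Rayleigh bound on the range through the Euclidean norm
    of the edge differences to their l1 norm, which is the disagreement, and ends with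
    Cauchy-Schwarz against \<open>p\<close>.\<close>
  have "sqrt ?l * norm p = sqrt (?l * (norm p)\<^sup>2)" by (simp add: real_sqrt_mult)
  also have "\<dots> \<le> norm (transpose B *v p)"
    using lambda2_gram_le[OF B0 p] by (intro real_le_lsqrt) auto
  also have "transpose B *v p = transpose B *v flatten X"
    unfolding pq matrix_vector_right_distrib Bq by simp
  also have "norm \<dots> \<le> disagreement A X"
    unfolding disagreement_eq_l1_incidence[OF e] B_def by (rule norm_le_l1_cart)
  also have "\<dots> \<le> norm \<eta> * norm p"
    using 1 norm_cauchy_schwarz[of "flatten \<eta>" p] by (simp add: norm_flatten)
  finally have "sqrt ?l \<le> norm \<eta>" using \<open>p \<noteq> 0\<close> by simp
  then show ?thesis using sqrt_le_D by blast
qed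

end

section \<open>Lebesgue points and derivatives along a trajectory\<close>

text \<open>A zero with nonzero slope is isolated, so a rational interval around it contains no
  other zero, and these intervals tell the zeros apart. At all other times the absolute value of a
  differentiable function is differentiable.\<close>

lemma countable_zeros_with_nonzero_deriv:
  fixes w :: "real \<Rightarrow> real"
  shows "countable {t. w t = 0 \<and> (\<exists>D. D \<noteq> 0 \<and> (w has_real_derivative D) (at t))}" (is "countable ?Z")
proof -
  define Z where "Z = ?Z"
  define P where "P = (\<lambda>t q. q \<in> \<rat> \<times> \<rat> \<and> fst q < t \<and> t < snd q \<and>
    (\<forall>s. fst q < s \<and> s < snd q \<and> w s = 0 \<longrightarrow> s = t))"
  have "\<exists>q. P t q" if t: "t \<in> Z" for t
  proof -
    obtain D where D: "w t = 0" "D \<noteq> 0" "(w has_real_derivative D) (at t)" using t unfolding Z_def by blast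
    have "((\<lambda>s. (w s - w t) / (s - t)) \<longlongrightarrow> D) (at t)"
      using D(3) by (simp add: has_field_derivative_iff)
    then have "\<forall>\<^sub>F s in at t. (w s - w t) / (s - t) \<noteq> 0"
      using D(2) by (rule tendsto_imp_eventually_ne)
    then obtain d where d: "0 < d" "\<And>s. s \<noteq> t \<Longrightarrow> dist s t < d \<Longrightarrow> w s \<noteq> 0"
      using D(1) unfolding eventually_at by auto
    obtain p q where "p \<in> \<rat>" "t - d < p" "p < t" "q \<in> \<rat>" "t < q" "q < t + d"
      using Rats_dense_in_real[of "t - d" t] Rats_dense_in_real[of t "t + d"] d(1) by auto
    then have "P t (p, q)" using d(2) unfolding P_def by (force simp: dist_real_def)
    then show ?thesis ..
  qed
  then obtain h where h: "\<And>t. t \<in> Z \<Longrightarrow> P t (h t)" by metis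
  have "inj_on h Z"
  proof (rule inj_onI)
    fix s t assume st: "s \<in> Z" "t \<in> Z" "h s = h t"
    have "w s = 0" using st(1) by (simp add: Z_def)
    then show "s = t" using h[OF st(1)] h[OF st(2)] st(3) by (auto simp: P_def)
  qed
  moreover have "countable (h ` Z)"
  proof (rule countable_subset)
    show "h ` Z \<subseteq> \<rat> \<times> \<rat>" using h unfolding P_def by blast
    show "countable (\<rat> \<times> \<rat> :: (real \<times> real) set)" by (intro countable_SIGMA countable_rat)
  qed
  ultimately show ?thesis using countable_image_inj_on Z_def by blast
qed

lemma has_real_derivative_abs:
  fixes w :: "real \<Rightarrow> real"
  assumes "(w has_real_derivative D) (at t)" "w t = 0 \<Longrightarrow> D = 0"
  shows "\<exists>D'. ((\<lambda>s. \<bar>w s\<bar>) has_real_derivative D') (at t)"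
proof (cases "w t = 0")
  case True
  then have "(w has_derivative (\<lambda>_. 0)) (at t)"
    using assms(2)[OF True] assms(1) unfolding has_field_derivative_def by (simp add: lambda_zero)
  then have "((\<lambda>s. \<bar>w s\<bar>) has_derivative (\<lambda>_. 0)) (at t)"
    using True unfolding has_derivative_at_alt by simp
  then have "((\<lambda>s. \<bar>w s\<bar>) has_real_derivative 0) (at t)"
    by (simp add: has_field_derivative_def lambda_zero)
  then show ?thesis ..
next
  case False
  have "((\<lambda>s. norm (w s)) has_derivative (\<lambda>h. (D * h) \<bullet> sgn (w t))) (at t)"
    using assms(1) has_derivative_norm[OF False] unfolding has_field_derivative_def
    by (rule has_derivative_compose)
  moreover have "(\<lambda>h. (D * h) \<bullet> sgn (w t)) = (*) (D * sgn (w t))" by (auto simp: fun_eq_iff)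
  ultimately have "((\<lambda>s. \<bar>w s\<bar>) has_real_derivative D * sgn (w t)) (at t)"
    unfolding has_field_derivative_def by simp
  then show ?thesis ..
qed

text \<open>The library's Lebesgue differentiation theorem is one-sided.\<close>

lemma lebesgue_point:
  fixes \<omega> :: "real \<Rightarrow> real"
  assumes int: "\<And>a b. \<omega> integrable_on {a..b}"
  obtains N where "negligible N" "\<And>t \<epsilon>. t \<notin> N \<Longrightarrow> 0 < \<epsilon> \<Longrightarrow> \<exists>d>0. \<forall>h. 0 < h \<and> h < d \<longrightarrow>
    integral {t..t+h} \<omega> \<le> (\<omega> t + \<epsilon>) * h \<and> integral {t-h..t} \<omega> \<le> (\<omega> t + \<epsilon>) * h"
proof -
  have *: "\<exists>N. negligible N \<and> (\<forall>t \<epsilon>. t \<notin> N \<and> 0 < \<epsilon> \<longrightarrow> (\<exists>d>0. \<forall>h. 0 < h \<and> h < d \<longrightarrow>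
      integral {t..t+h} f \<le> (f t + \<epsilon>) * h))" if f: "\<And>a b. f integrable_on {a..b}" for f :: "real \<Rightarrow> real"
  proof -
    obtain N where N: "negligible N" "\<And>x e. \<lbrakk>x \<notin> N; 0 < e\<rbrakk> \<Longrightarrow>
        \<exists>d>0. \<forall>h. 0 < h \<and> h < d \<longrightarrow> norm (integral (cbox x (x + h *\<^sub>R One)) f /\<^sub>R h ^ DIM(real) - f x) < e"
      using integrable_ccontinuous_explicit[of f] f by (metis cbox_interval)
    have "\<exists>d>0. \<forall>h. 0 < h \<and> h < d \<longrightarrow> integral {t..t+h} f \<le> (f t + \<epsilon>) * h"
      if t: "t \<notin> N" and \<epsilon>: "0 < \<epsilon>" for t \<epsilon>
    proof -
      obtain d where "0 < d" and d: "\<forall>h. 0 < h \<and> h < d \<longrightarrow>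
          norm (integral (cbox t (t + h *\<^sub>R One)) f /\<^sub>R h ^ DIM(real) - f t) < \<epsilon>"
        using N(2)[OF t \<epsilon>] by blast
      have "integral {t..t+h} f \<le> (f t + \<epsilon>) * h" if "0 < h" "h < d" for h
      proof -
        have "\<bar>integral {t..t+h} f / h - f t\<bar> < \<epsilon>"
          using d that by (simp add: divide_inverse mult.commute)
        then have "integral {t..t+h} f / h \<le> f t + \<epsilon>" by linarith
        then show ?thesis using \<open>0 < h\<close> by (simp add: field_simps)
      qed
      then show ?thesis using \<open>0 < d\<close> by blast
    qed
    then show ?thesis using N(1) by blast
  qed
  obtain N1 where N1: "negligible N1" "\<And>t \<epsilon>. t \<notin> N1 \<Longrightarrow> 0 < \<epsilon> \<Longrightarrow> \<exists>d>0. \<forall>h. 0 < h \<and> h < d \<longrightarrow>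
      integral {t..t+h} \<omega> \<le> (\<omega> t + \<epsilon>) * h"
    using *[of \<omega>] int by blast
  \<comment> \<open>Reflection turns forward intervals at \<open>- t\<close> into backward intervals
    at \<open>t\<close>.\<close>
  have "(\<lambda>s. \<omega> (- s)) integrable_on {a..b}" for a b
    using int[of "-b" "-a"] Henstock_Kurzweil_Integration.integrable_reflect_real[where f=\<omega> and a="-b" and b="-a"] by (simp only: minus_minus)
  from *[OF this] obtain N2 where N2: "negligible N2" "\<forall>t \<epsilon>. t \<notin> N2 \<and> 0 < \<epsilon> \<longrightarrow> (\<exists>d>0. \<forall>h. 0 < h \<and> h < d \<longrightarrow>
      integral {t..t+h} (\<lambda>s. \<omega> (- s)) \<le> (\<omega> (- t) + \<epsilon>) * h)"
    by blast
  show ?thesis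
  proof (rule that)
    show "negligible (N1 \<union> uminus ` N2)"
      using N1(1) N2(1)
      by (intro negligible_Un negligible_differentiable_image_negligible linear_imp_differentiable_on)
        (auto simp: linear_iff)
    fix t \<epsilon> :: real assume t: "t \<notin> N1 \<union> uminus ` N2" and "0 < \<epsilon>"
    then have "- t \<notin> N2" by force
    obtain d1 where d1: "0 < d1" "\<forall>h. 0 < h \<and> h < d1 \<longrightarrow> integral {t..t+h} \<omega> \<le> (\<omega> t + \<epsilon>) * h"
      using N1(2) t \<open>0 < \<epsilon>\<close> by blast
    obtain d2 where d2: "0 < d2" "\<forall>h. 0 < h \<and> h < d2 \<longrightarrow>
        integral {-t..-t+h} (\<lambda>s. \<omega> (- s)) \<le> (\<omega> (- (- t)) + \<epsilon>) * h"
      using N2(2) \<open>- t \<notin> N2\<close> \<open>0 < \<epsilon>\<close> by blast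
    have "integral {-t..-t+h} (\<lambda>s. \<omega> (- s)) = integral {t-h..t} \<omega>" for h
      using Henstock_Kurzweil_Integration.integral_reflect_real[of t "t - h" \<omega>] by simp
    then show "\<exists>d>0. \<forall>h. 0 < h \<and> h < d \<longrightarrow>
        integral {t..t+h} \<omega> \<le> (\<omega> t + \<epsilon>) * h \<and> integral {t-h..t} \<omega> \<le> (\<omega> t + \<epsilon>) * h"
      using d1 d2 by (intro exI[of _ "min d1 d2"]) auto
  qed
qed

text \<open>Off the Lebesgue points of \<open>\<epsilon> + 2 * \<kappa> * indicator Bad\<close>, where \<open>Bad\<close> is the set of times at which
  \<open>dg\<close> oscillates by more than \<open>\<epsilon>\<close> over a ball with centre in a countable dense set, the time
  increments of \<open>g\<close> at neighbouring points agree to first order.\<close>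

lemma time_increment_uniform:
  fixes g dg :: "'a::euclidean_space \<Rightarrow> real \<Rightarrow> 'b::euclidean_space"
  assumes deriv: "\<And>x t. 0 \<le> t \<Longrightarrow> ((\<lambda>s. g x s) has_vector_derivative dg x t) (at t within {0..})"
    and meas: "\<And>x. (\<lambda>t. dg x t) \<in> borel_measurable (lebesgue_on {0..})"
    and cont: "\<And>t. 0 \<le> t \<Longrightarrow> continuous_on UNIV (\<lambda>x. dg x t)"
    and bound: "\<And>x t. 0 \<le> t \<Longrightarrow> norm (dg x t) \<le> \<kappa>"
  obtains N where "negligible N" "\<And>t x \<epsilon>. 0 < t \<Longrightarrow> t \<notin> N \<Longrightarrow> 0 < \<epsilon> \<Longrightarrow>
    \<exists>d>0. \<forall>y s. dist y x < d \<and> dist s t < d \<longrightarrow>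
      norm ((g y s - g y t) - (g x s - g x t)) \<le> \<epsilon> * \<bar>s - t\<bar>"
proof -
  obtain Q :: "'a set" where Q: "countable Q" "\<And>S. open S \<Longrightarrow> S \<noteq> {} \<Longrightarrow> \<exists>q\<in>Q. q \<in> S"
    using countable_dense_exists by metis
  define r where "r = (\<lambda>j::nat. inverse (real (Suc j)))"
  have r: "0 < r j" for j by (simp add: r_def)
  \<comment> \<open>Testing the oscillation on the countable set \<open>Q\<close> keeps
    \<open>Bad\<close> measurable; \<open>osc\<close> recovers all points of the ball from density
    and continuity. The weight \<open>2 * \<kappa>\<close> in \<open>\<omega>\<close> is the trivial
    bound on \<open>Bad\<close>.\<close>
  define Bad where "Bad = (\<lambda>q j k. {s. 0 \<le> s \<and> (\<exists>x\<in>Q \<inter> ball q (r j). r k < norm (dg x s - dg q s))})"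
  define \<omega> where "\<omega> = (\<lambda>q j k s. r k + 2 * \<kappa> * indicator (Bad q j k) s)"
  have \<kappa>: "0 \<le> \<kappa>" using bound[of 0 0] norm_ge_zero[of "dg 0 0"] by linarith
  have "Bad q j k \<in> sets lebesgue" for q j k
  proof -
    have "{s \<in> space (lebesgue_on {0..}). r k < norm (dg x s - dg q s)} \<in> sets (lebesgue_on {0..})" for x
      using meas by measurable
    then have "{s \<in> {0..}. r k < norm (dg x s - dg q s)} \<in> sets lebesgue" for x
      by (simp add: sets_restrict_space_iff space_restrict_space)
    then have "(\<Union>x\<in>Q \<inter> ball q (r j). {s \<in> {0..}. r k < norm (dg x s - dg q s)}) \<in> sets lebesgue"
      using Q(1) by (intro sets.countable_UN') auto
    moreover have "(\<Union>x\<in>Q \<inter> ball q (r j). {s \<in> {0..}. r k < norm (dg x s - dg q s)}) = Bad q j k"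
      by (auto simp: Bad_def)
    ultimately show ?thesis by simp
  qed
  then have "Bad q j k \<inter> {a..b} \<in> lmeasurable" for q j k a b
    by (intro bounded_set_imp_lmeasurable) (auto intro: bounded_subset[OF bounded_closed_interval])
  then have "indicat_real (Bad q j k) integrable_on {a..b}" for q j k a b
    by (simp add: integrable_on_indicator)
  then have int: "\<omega> q j k integrable_on {a..b}" for q j k a b
    unfolding \<omega>_def by (intro integrable_add integrable_on_mult_right integrable_const_ivl)
  have "\<exists>N. negligible N \<and> (\<forall>t \<epsilon>. t \<notin> N \<and> 0 < \<epsilon> \<longrightarrow> (\<exists>d>0. \<forall>h. 0 < h \<and> h < d \<longrightarrow>
      integral {t..t+h} (\<omega> q j k) \<le> (\<omega> q j k t + \<epsilon>) * h \<and> integral {t-h..t} (\<omega> q j k) \<le> (\<omega> q j k t + \<epsilon>) * h))"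
    for q j k
    by (rule lebesgue_point[OF int[of q j k]]) blast
  then obtain N where N: "\<And>q j k. negligible (N q j k)"
    and leb: "\<And>q j k t \<epsilon>. t \<notin> N q j k \<Longrightarrow> 0 < \<epsilon> \<Longrightarrow> \<exists>d>0. \<forall>h. 0 < h \<and> h < d \<longrightarrow>
      integral {t..t+h} (\<omega> q j k) \<le> (\<omega> q j k t + \<epsilon>) * h \<and> integral {t-h..t} (\<omega> q j k) \<le> (\<omega> q j k t + \<epsilon>) * h"
    by metis
  have osc: "norm (dg x s - dg q s) \<le> \<omega> q j k s" if s: "0 \<le> s" and x: "x \<in> ball q (r j)" for x s q j k
  proof (cases "s \<in> Bad q j k")
    case True
    have "norm (dg x s - dg q s) \<le> \<kappa> + \<kappa>"
      using norm_triangle_ineq4[of "dg x s" "dg q s"] bound[OF s, of x] bound[OF s, of q] by linarith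
    then show ?thesis using True r[of k] by (simp add: \<omega>_def)
  next
    case False
    have "norm (dg x s - dg q s) \<le> r k"
    proof (rule ccontr)
      assume *: "\<not> ?thesis"
      have "open {y. r k < norm (dg y s - dg q s)}"
        using cont[OF s] by (intro open_Collect_less continuous_intros)
      then have "open ({y. r k < norm (dg y s - dg q s)} \<inter> ball q (r j))" by auto
      moreover have "x \<in> {y. r k < norm (dg y s - dg q s)} \<inter> ball q (r j)" using * x by auto
      ultimately obtain y where "y \<in> Q" "y \<in> {y. r k < norm (dg y s - dg q s)} \<inter> ball q (r j)"
        using Q(2) by blast
      then have "s \<in> Bad q j k" using s by (auto simp: Bad_def)
      then show False using False by contradiction
    qed
    then show ?thesis using False by (simp add: \<omega>_def)
  qed
  show ?thesis
  proof (rule that)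
    \<comment> \<open>Only countably many centres, radii and thresholds contribute, so the
      exceptional set does not depend on \<open>x\<close>.\<close>
    show "negligible (\<Union>q\<in>Q. \<Union>j. \<Union>k. N q j k)"
      using N Q(1) by (intro negligible_countable_Union) (auto intro!: negligible_countable_Union)
    fix t x and \<epsilon> :: real
    assume "0 < t" and t: "t \<notin> (\<Union>q\<in>Q. \<Union>j. \<Union>k. N q j k)" and "0 < \<epsilon>"
    \<comment> \<open>The quarter is used up by two factors of 2: both points are compared with the
      centre \<open>q\<close>, and the Lebesgue point estimate replaces \<open>r k\<close> by
      \<open>r k + r k\<close>.\<close>
    obtain k where k: "r k < \<epsilon> / 4"
      using reals_Archimedean[of "\<epsilon> / 4"] \<open>0 < \<epsilon>\<close> by (auto simp: r_def)
    have "continuous_on UNIV (\<lambda>x. dg x t)" using cont \<open>0 < t\<close> by simp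
    then obtain \<rho> where \<rho>: "0 < \<rho>" "\<And>y. dist y x < \<rho> \<Longrightarrow> dist (dg y t) (dg x t) < r k / 2"
      unfolding continuous_on_iff using r[of k] by (meson UNIV_I half_gt_zero)
    obtain j where j: "r j < \<rho> / 2"
      using reals_Archimedean[of "\<rho> / 2"] \<rho>(1) by (auto simp: r_def)
    obtain q where q: "q \<in> Q" "dist x q < r j"
      using Q(2)[of "ball x (r j)"] r[of j] by auto
    \<comment> \<open>Continuity in space at the single time \<open>t\<close> keeps the oscillation
      around \<open>q\<close> below \<open>r k\<close>, so \<open>\<omega>\<close> takes its small
      value there.\<close>
    have "t \<notin> Bad q j k"
    proof
      assume "t \<in> Bad q j k"
      then obtain y where y: "dist q y < r j" "r k < norm (dg y t - dg q t)"
        by (auto simp: Bad_def)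
      have "dist y x < \<rho>" using y(1) q(2) j dist_triangle[of y x q] by (simp add: dist_commute)
      moreover have "dist q x < \<rho>" using q(2) j r[of j] by (simp add: dist_commute)
      ultimately have "dist (dg y t) (dg x t) < r k / 2" "dist (dg q t) (dg x t) < r k / 2"
        using \<rho>(2) by blast+
      then have "dist (dg y t) (dg q t) < r k"
        using dist_triangle2[of "dg y t" "dg q t" "dg x t"] by linarith
      then show False using y(2) by (simp add: dist_norm)
    qed
    then have \<omega>t: "\<omega> q j k t = r k" by (simp add: \<omega>_def)
    have "t \<notin> N q j k" using t q(1) by auto
    then obtain d1 where d1: "0 < d1" "\<And>h. 0 < h \<Longrightarrow> h < d1 \<Longrightarrow>
        integral {t..t+h} (\<omega> q j k) \<le> (r k + r k) * h \<and> integral {t-h..t} (\<omega> q j k) \<le> (r k + r k) * h"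
      using leb[of t q j k "r k"] r[of k] unfolding \<omega>t by blast
    have "x \<in> ball q (r j)" using q(2) by (simp add: dist_commute)
    then obtain d2 where d2: "0 < d2" "ball x d2 \<subseteq> ball q (r j)"
      by (meson open_ball open_contains_ball)
    have incr: "norm ((g y b - g x b) - (g y a - g x a)) \<le> 2 * integral {a..b} (\<omega> q j k)"
      if "0 \<le> a" "a \<le> b" "y \<in> ball q (r j)" for a b y
    proof -
      have der: "((\<lambda>s. g y s - g x s) has_vector_derivative (dg y s - dg x s)) (at s within {a..b})"
        if "s \<in> {a..b}" for s
      proof (rule has_vector_derivative_within_subset)
        show "((\<lambda>s. g y s - g x s) has_vector_derivative (dg y s - dg x s)) (at s within {0..})"
          using that \<open>0 \<le> a\<close> by (intro has_vector_derivative_diff deriv) auto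
      qed (use \<open>0 \<le> a\<close> in auto)
      have I: "((\<lambda>s. dg y s - dg x s) has_integral ((g y b - g x b) - (g y a - g x a))) {a..b}"
        using fundamental_theorem_of_calculus[OF \<open>a \<le> b\<close> der] by simp
      have "norm (integral {a..b} (\<lambda>s. dg y s - dg x s)) \<le> integral {a..b} (\<lambda>s. 2 * \<omega> q j k s)"
      proof (rule integral_norm_bound_integral)
        show "(\<lambda>s. dg y s - dg x s) integrable_on {a..b}" using I by blast
        show "(\<lambda>s. 2 * \<omega> q j k s) integrable_on {a..b}" using int by (intro integrable_on_mult_right)
        fix s assume "s \<in> {a..b}"
        then have "0 \<le> s" using \<open>0 \<le> a\<close> by simp
        have "norm (dg y s - dg x s) \<le> norm (dg y s - dg q s) + norm (dg x s - dg q s)"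
          by (metis dist_norm dist_triangle2)
        then show "norm (dg y s - dg x s) \<le> 2 * \<omega> q j k s"
          using osc[OF \<open>0 \<le> s\<close> that(3), of k] osc[OF \<open>0 \<le> s\<close> \<open>x \<in> ball q (r j)\<close>, of k] by linarith
      qed
      then show ?thesis using I by (simp add: integral_unique)
    qed
    show "\<exists>d>0. \<forall>y s. dist y x < d \<and> dist s t < d \<longrightarrow>
      norm ((g y s - g y t) - (g x s - g x t)) \<le> \<epsilon> * \<bar>s - t\<bar>"
    proof (intro exI[of _ "min d1 (min d2 t)"] conjI allI impI)
      show "0 < min d1 (min d2 t)" using d1(1) d2(1) \<open>0 < t\<close> by simp
      fix y s assume ys: "dist y x < min d1 (min d2 t) \<and> dist s t < min d1 (min d2 t)"
      have y: "y \<in> ball q (r j)" using ys d2(2) by (auto simp: dist_commute)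
      have s: "0 < s" "\<bar>s - t\<bar> < d1" using ys by (auto simp: dist_real_def)
      have small: "2 * ((r k + r k) * \<bar>s - t\<bar>) \<le> \<epsilon> * \<bar>s - t\<bar>"
        using mult_right_mono[of "2 * (r k + r k)" \<epsilon> "\<bar>s - t\<bar>"] k by (simp add: mult.assoc)
      consider "s < t" | "s = t" | "t < s" by linarith
      then show "norm ((g y s - g y t) - (g x s - g x t)) \<le> \<epsilon> * \<bar>s - t\<bar>"
      proof cases
        case 1
        have "norm ((g y t - g x t) - (g y s - g x s)) \<le> 2 * integral {s..t} (\<omega> q j k)"
          using s 1 y by (intro incr) auto
        also have "\<dots> \<le> 2 * ((r k + r k) * \<bar>s - t\<bar>)"
          using d1(2)[of "t - s"] s 1 by simp
        also have "norm ((g y t - g x t) - (g y s - g x s)) = norm ((g y s - g y t) - (g x s - g x t))"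
          using norm_minus_commute[of "g y t - g x t" "g y s - g x s"] by (simp add: algebra_simps)
        finally show ?thesis using small by linarith
      next
        case 3
        have "norm ((g y s - g x s) - (g y t - g x t)) \<le> 2 * integral {t..s} (\<omega> q j k)"
          using \<open>0 < t\<close> 3 y by (intro incr) auto
        also have "\<dots> \<le> 2 * ((r k + r k) * \<bar>s - t\<bar>)"
          using d1(2)[of "s - t"] s 3 by simp
        finally show ?thesis using small by (simp add: algebra_simps)
      qed simp
    qed
  qed
qed

lemma has_vector_derivative_along:
  fixes g :: "'a::euclidean_space \<Rightarrow> real \<Rightarrow> 'b::euclidean_space"
  assumes x: "(x has_vector_derivative v) (at t)"
    and space: "((\<lambda>y. g y t) has_derivative G) (at (x t))"
    and time: "((\<lambda>s. g (x t) s) has_vector_derivative w) (at t)"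
    and incr: "\<And>\<epsilon>. 0 < \<epsilon> \<Longrightarrow> \<exists>d>0. \<forall>y s. dist y (x t) < d \<and> dist s t < d \<longrightarrow>
      norm ((g y s - g y t) - (g (x t) s - g (x t) t)) \<le> \<epsilon> * \<bar>s - t\<bar>"
  shows "((\<lambda>s. g (x s) s) has_vector_derivative (G v + w)) (at t)"
proof -
  define R where "R = (\<lambda>s. (g (x s) s - g (x s) t) - (g (x t) s - g (x t) t))"
  have "continuous (at t) x" by (rule has_vector_derivative_continuous[OF x])
  have "(R has_derivative (\<lambda>_. 0)) (at t)"
    unfolding has_derivative_at_alt
  proof (intro conjI allI impI)
    fix \<epsilon> :: real assume "0 < \<epsilon>"
    obtain d where d: "0 < d" "\<And>y s. dist y (x t) < d \<Longrightarrow> dist s t < d \<Longrightarrow>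
      norm ((g y s - g y t) - (g (x t) s - g (x t) t)) \<le> \<epsilon> * \<bar>s - t\<bar>"
      using incr[OF \<open>0 < \<epsilon>\<close>] by blast
    obtain d' where d': "0 < d'" "\<And>s. dist s t < d' \<Longrightarrow> dist (x s) (x t) < d"
      using \<open>continuous (at t) x\<close> d(1) unfolding continuous_at_eps_delta by (metis dist_commute)
    show "\<exists>d>0. \<forall>y. norm (y - t) < d \<longrightarrow> norm (R y - R t - 0) \<le> \<epsilon> * norm (y - t)"
      using d d' by (intro exI[of _ "min d d'"]) (auto simp: R_def dist_real_def)
  qed simp
  then have R: "(R has_vector_derivative 0) (at t)"
    by (simp add: has_vector_derivative_def)
  have 1: "((\<lambda>s. g (x s) t) has_vector_derivative G v) (at t)"
  proof -
    have "((\<lambda>s. g (x s) t) has_derivative (\<lambda>h. G (h *\<^sub>R v))) (at t)"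
      using has_derivative_compose[OF x[unfolded has_vector_derivative_def] space] .
    moreover have "(\<lambda>h. G (h *\<^sub>R v)) = (\<lambda>h. h *\<^sub>R G v)"
      using linear_scale[OF has_derivative_linear[OF space]] by blast
    ultimately show ?thesis by (simp add: has_vector_derivative_def)
  qed
  have "((\<lambda>s. g (x s) t + (g (x t) s - g (x t) t) + R s) has_vector_derivative (G v + (w - 0) + 0)) (at t)"
    by (intro has_vector_derivative_add has_vector_derivative_diff 1 R time has_vector_derivative_const)
  then show ?thesis by (simp add: R_def)
qed

section \<open>Uniformly definite Hessians\<close>

lemma norm_matrix_vector_mult_le:
  fixes M :: "real^'n^'m"
  shows "norm (M *v x) \<le> real CARD('m) * norm M * norm x"
proof -
  have "norm (M *v x) \<le> (\<Sum>i\<in>UNIV. \<bar>(M *v x) $ i\<bar>)" by (rule norm_le_l1_cart)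
  also have "\<dots> \<le> (\<Sum>i\<in>(UNIV::'m set). norm M * norm x)"
  proof (rule sum_mono)
    fix i
    have "\<bar>(M *v x) $ i\<bar> = \<bar>M $ i \<bullet> x\<bar>" by (simp add: matrix_vector_mul_component)
    also have "\<dots> \<le> norm (M $ i) * norm x" by (rule Cauchy_Schwarz_ineq2)
    also have "\<dots> \<le> norm M * norm x" by (intro mult_right_mono Finite_Cartesian_Product.norm_nth_le) auto
    finally show "\<bar>(M *v x) $ i\<bar> \<le> norm M * norm x" .
  qed
  finally show ?thesis by (simp add: mult.assoc)
qed

context
  fixes M :: "real^'n^'n" and l u :: real
  assumes lower: "loewner_le (l *\<^sub>R mat 1) M" and upper: "loewner_le M (u *\<^sub>R mat 1)"
    and pos: "0 < l" "0 < u"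
begin

lemma loewner_symmetric: "w \<bullet> (M *v v) = v \<bullet> (M *v w)"
proof -
  have "transpose (M - l *\<^sub>R mat 1) = M - l *\<^sub>R mat 1"
    using lower by (simp add: loewner_le_def positive_semidefinite_def)
  moreover have "transpose (M - l *\<^sub>R mat 1) = transpose M - l *\<^sub>R mat 1"
    by (auto simp: transpose_def vec_eq_iff mat_def)
  ultimately have "transpose M = M" by (metis add_diff_cancel diff_add_cancel)
  then show ?thesis by (metis dot_lmul_matrix inner_commute transpose_matrix_vector)
qed

lemma loewner_lower: "l * (norm v)\<^sup>2 \<le> v \<bullet> (M *v v)"
proof -
  have "0 \<le> v \<bullet> ((M - l *\<^sub>R mat 1) *v v)"
    using lower by (simp add: loewner_le_def positive_semidefinite_def)
  also have "\<dots> = v \<bullet> (M *v v) - l * (v \<bullet> v)"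
    by (simp add: matrix_vector_mult_diff_rdistrib inner_diff_right flip: scaleR_matrix_vector_assoc)
  finally show ?thesis by (simp add: power2_norm_eq_inner)
qed

lemma loewner_upper: "v \<bullet> (M *v v) \<le> u * (norm v)\<^sup>2"
proof -
  have "0 \<le> v \<bullet> ((u *\<^sub>R mat 1 - M) *v v)"
    using upper by (simp add: loewner_le_def positive_semidefinite_def)
  also have "\<dots> = u * (v \<bullet> v) - v \<bullet> (M *v v)"
    by (simp add: matrix_vector_mult_diff_rdistrib inner_diff_right flip: scaleR_matrix_vector_assoc)
  finally show ?thesis by (simp add: power2_norm_eq_inner)
qed

lemma loewner_norm_lower: "l * norm v \<le> norm (M *v v)"
proof (cases "v = 0")
  case False
  have "l * (norm v)\<^sup>2 \<le> norm v * norm (M *v v)"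
    using loewner_lower norm_cauchy_schwarz order_trans by blast
  then show ?thesis using False by (simp add: power2_eq_square mult.assoc mult.left_commute[of l])
qed simp

lemma loewner_inj: "inj ((*v) M)"
proof (rule injI)
  fix x y assume "M *v x = M *v y"
  then have "M *v (x - y) = 0" by (simp add: matrix_vector_mult_diff_distrib)
  then have "l * norm (x - y) \<le> 0" using loewner_norm_lower[of "x - y"] by simp
  then show "x = y" using pos by (simp add: mult_le_0_iff)
qed

lemma loewner_mult_inv: "M *v (matrix_inv M *v v) = v"
proof -
  have "invertible M"
    using loewner_inj matrix_left_invertible_injective invertible_left_inverse by blast
  then have "M ** matrix_inv M = mat 1"
    unfolding invertible_def matrix_inv_def by (rule someI_ex[THEN conjunct1])
  then show ?thesis by (simp add: matrix_vector_mul_assoc)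
qed

text \<open>Expand \<open>0 \<le> x \<bullet> (M *v x)\<close> at \<open>x = v - (1 / u) *\<^sub>R (M *v v)\<close>.\<close>

lemma loewner_norm_image: "(norm (M *v v))\<^sup>2 \<le> u * (v \<bullet> (M *v v))"
proof -
  let ?w = "M *v v"
  let ?x = "v - (1 / u) *\<^sub>R ?w"
  have "0 \<le> ?x \<bullet> (M *v ?x)"
    using loewner_lower[of ?x] pos by (meson less_imp_le mult_nonneg_nonneg order_trans zero_le_power2)
  also have "M *v ?x = ?w - (1 / u) *\<^sub>R (M *v ?w)"
    by (simp add: matrix_vector_mult_diff_distrib matrix_vector_mult_scaleR)
  also have "?x \<bullet> (?w - (1 / u) *\<^sub>R (M *v ?w)) =
      v \<bullet> ?w - (1 / u) * (v \<bullet> (M *v ?w)) - (1 / u) * (?w \<bullet> ?w) + (1 / u)\<^sup>2 * (?w \<bullet> (M *v ?w))"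
    by (simp add: inner_diff_left inner_diff_right power2_eq_square algebra_simps)
  also have "v \<bullet> (M *v ?w) = ?w \<bullet> ?w" by (rule loewner_symmetric)
  also have "(1 / u)\<^sup>2 * (?w \<bullet> (M *v ?w)) \<le> (1 / u)\<^sup>2 * (u * (norm ?w)\<^sup>2)"
    by (intro mult_left_mono loewner_upper) simp
  also have "(1 / u)\<^sup>2 * (u * (norm ?w)\<^sup>2) = (1 / u) * (?w \<bullet> ?w)"
    using pos by (simp add: power2_norm_eq_inner power2_eq_square[of "1 / u"])
  finally have "(1 / u) * (?w \<bullet> ?w) \<le> v \<bullet> ?w" by simp
  then show ?thesis using pos by (simp add: power2_norm_eq_inner field_simps)
qed

text \<open>Read with \<open>d = M *v v\<close>, this bounds the inverse form of \<open>d\<close> by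
  its squared norm over \<open>l\<close>; with \<open>loewner_norm_image\<close> it gives the two
  spectral bounds of the inverse without mentioning it.\<close>

lemma loewner_form_le: "l * (v \<bullet> (M *v v)) \<le> (norm (M *v v))\<^sup>2"
proof -
  have "l * (v \<bullet> (M *v v)) \<le> l * (norm v * norm (M *v v))"
    using pos by (intro mult_left_mono norm_cauchy_schwarz) auto
  also have "\<dots> = (l * norm v) * norm (M *v v)" by simp
  also have "\<dots> \<le> norm (M *v v) * norm (M *v v)" by (intro mult_right_mono loewner_norm_lower) auto
  finally show ?thesis by (simp add: power2_eq_square)
qed

lemma loewner_norm_upper: "norm (M *v v) \<le> u * norm v"
proof (rule power2_le_imp_le)
  have "(norm (M *v v))\<^sup>2 \<le> u * (u * (norm v)\<^sup>2)"
    using loewner_norm_image[of v] mult_left_mono[OF loewner_upper[of v], of u] pos by linarith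
  then show "(norm (M *v v))\<^sup>2 \<le> (u * norm v)\<^sup>2" by (simp add: power2_eq_square mult_ac)
qed (use pos in auto)

text \<open>Young's inequality for the inner product defined by \<open>M\<close>: expand the form at
  \<open>\<beta> *\<^sub>R w + e\<close> and divide by \<open>2 * \<beta>\<close>.\<close>

lemma loewner_young:
  assumes "0 < \<beta>"
  shows "- (w \<bullet> (M *v e)) \<le> \<beta> / 2 * (w \<bullet> (M *v w)) + (e \<bullet> (M *v e)) / (2 * \<beta>)"
proof -
  let ?x = "\<beta> *\<^sub>R w + e"
  have "0 \<le> ?x \<bullet> (M *v ?x)"
    using loewner_lower[of ?x] pos by (meson less_imp_le mult_nonneg_nonneg order_trans zero_le_power2)
  also have "M *v ?x = \<beta> *\<^sub>R (M *v w) + M *v e"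
    by (simp add: matrix_vector_right_distrib matrix_vector_mult_scaleR)
  also have "?x \<bullet> (\<beta> *\<^sub>R (M *v w) + M *v e) =
      \<beta>\<^sup>2 * (w \<bullet> (M *v w)) + \<beta> * (w \<bullet> (M *v e)) + \<beta> * (e \<bullet> (M *v w)) + e \<bullet> (M *v e)"
    by (simp add: inner_add_left inner_add_right power2_eq_square algebra_simps)
  also have "e \<bullet> (M *v w) = w \<bullet> (M *v e)" by (rule loewner_symmetric)
  finally have "0 \<le> \<beta>\<^sup>2 * (w \<bullet> (M *v w)) + 2 * \<beta> * (w \<bullet> (M *v e)) + e \<bullet> (M *v e)" by simp
  then have "0 \<le> (\<beta>\<^sup>2 * (w \<bullet> (M *v w)) + 2 * \<beta> * (w \<bullet> (M *v e)) + e \<bullet> (M *v e)) / (2 * \<beta>)"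
    using assms by simp
  also have "\<dots> = \<beta> / 2 * (w \<bullet> (M *v w)) + w \<bullet> (M *v e) + (e \<bullet> (M *v e)) / (2 * \<beta>)"
    using assms by (simp add: field_simps power2_eq_square)
  finally show ?thesis by linarith
qed

end

text \<open>Solving for the velocity gives \<open>v = - (\<alpha> w + e)\<close> with
  \<open>M w = \<eta>\<close> and \<open>M e = d\<close>. The first part contributes
  \<open>- \<alpha> a\<close>, where \<open>a\<close> is the sum of the forms of \<open>w\<close>;
  the cross term costs at most \<open>\<beta> a\<close>. The equation for \<open>\<beta>\<close> is
  the balance at which Young's inequality gives this cost.\<close>

lemma subgradient_descent_rate:
  fixes M :: "'v::finite \<Rightarrow> real^'n^'n" and \<eta> v d :: "(real^'n)^'v"
  assumes lower: "\<And>i. loewner_le (l i *\<^sub>R mat 1) (M i)" and upper: "\<And>i. loewner_le (M i) (u i *\<^sub>R mat 1)"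
    and l: "0 < l0" "\<And>i. l0 \<le> l i" and u: "\<And>i. 0 < u i" "\<And>i. u i \<le> u0"
    and v: "\<And>i. M i *v (v $ i) = - (\<alpha> *\<^sub>R \<eta> $ i + d $ i)"
    and d: "\<And>i. norm (d $ i) \<le> \<kappa>"
    and \<Lambda>: "0 < \<Lambda>" "\<Lambda> \<le> (norm \<eta>)\<^sup>2"
    and \<beta>: "0 < \<beta>" "\<beta>\<^sup>2 * \<Lambda> * l0 = real CARD('v) * \<kappa>\<^sup>2 * u0" "\<beta> \<le> \<alpha>"
  shows "\<eta> \<bullet> v \<le> - ((\<alpha> - \<beta>) * (\<Lambda> / u0))"
proof -
  have pos: "0 < l i" "0 < u i" for i using l u[of i] order_less_le_trans[OF l(1) l(2)[of i]] by auto
  note facts = lower upper pos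
  have u0: "0 < u0" using u order_less_le_trans by blast
  define w where "w = (\<lambda>i. matrix_inv (M i) *v (\<eta> $ i))"
  define e where "e = (\<lambda>i. matrix_inv (M i) *v (d $ i))"
  have Mw: "M i *v w i = \<eta> $ i" and Me: "M i *v e i = d $ i" for i
    unfolding w_def e_def by (rule loewner_mult_inv[OF facts])+
  have vi: "v $ i = - (\<alpha> *\<^sub>R w i + e i)" for i
  proof -
    have "M i *v (v $ i) = M i *v (- (\<alpha> *\<^sub>R w i + e i))"
      unfolding v linear_neg[OF matrix_vector_mul_linear] matrix_vector_right_distrib
        matrix_vector_mult_scaleR Mw Me ..
    then show ?thesis using loewner_inj[OF facts] by (meson injD)
  qed
  define a where "a = (\<Sum>i\<in>UNIV. w i \<bullet> (M i *v w i))"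
  have "(norm \<eta>)\<^sup>2 = (\<Sum>i\<in>UNIV. (norm (M i *v w i))\<^sup>2)"
    by (simp add: Mw power2_norm_eq_inner inner_vec_def[of \<eta>])
  also have "\<dots> \<le> (\<Sum>i\<in>UNIV. u0 * (w i \<bullet> (M i *v w i)))"
  proof (rule sum_mono)
    fix i
    have "0 \<le> w i \<bullet> (M i *v w i)"
      using loewner_lower[OF facts, of i "w i"] pos(1)[of i]
      by (meson less_imp_le mult_nonneg_nonneg order_trans zero_le_power2)
    then have "u i * (w i \<bullet> (M i *v w i)) \<le> u0 * (w i \<bullet> (M i *v w i))"
      by (intro mult_right_mono u)
    then show "(norm (M i *v w i))\<^sup>2 \<le> u0 * (w i \<bullet> (M i *v w i))"
      using loewner_norm_image[OF facts, of i "w i"] by linarith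
  qed
  finally have "\<Lambda> \<le> u0 * a" using \<Lambda>(2) by (simp add: a_def sum_distrib_left)
  then have a: "\<Lambda> / u0 \<le> a" using u0 by (simp add: field_simps)
  define b where "b = (\<Sum>i\<in>UNIV. e i \<bullet> (M i *v e i))"
  have "l0 * b \<le> (\<Sum>i\<in>(UNIV::'v set). \<kappa>\<^sup>2)"
    unfolding b_def sum_distrib_left
  proof (rule sum_mono)
    fix i
    have "0 \<le> e i \<bullet> (M i *v e i)"
      using loewner_lower[OF facts, of i "e i"] pos(1)[of i]
      by (meson less_imp_le mult_nonneg_nonneg order_trans zero_le_power2)
    then have "l0 * (e i \<bullet> (M i *v e i)) \<le> l i * (e i \<bullet> (M i *v e i))"
      by (intro mult_right_mono l)
    also have "\<dots> \<le> (norm (d $ i))\<^sup>2" using loewner_form_le[OF facts, of i "e i"] by (simp add: Me)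
    also have "\<dots> \<le> \<kappa>\<^sup>2" using d by (intro power_mono) auto
    finally show "l0 * (e i \<bullet> (M i *v e i)) \<le> \<kappa>\<^sup>2" .
  qed
  \<comment> \<open>The equation for \<open>\<beta>\<close> turns the bound on the forms of
    \<open>e\<close> into a multiple of \<open>\<Lambda> / u0\<close>, which is itself below
    \<open>a\<close>.\<close>
  then have "l0 * b * u0 \<le> real CARD('v) * \<kappa>\<^sup>2 * u0" using u0 by (intro mult_right_mono) auto
  also have "\<dots> = \<beta>\<^sup>2 * \<Lambda> * l0" using \<beta> by simp
  finally have "l0 * (b * u0) \<le> l0 * (\<beta>\<^sup>2 * \<Lambda>)" by (simp add: mult_ac)
  then have "b * u0 \<le> \<beta>\<^sup>2 * \<Lambda>" using l(1) by simp
  then have "b \<le> \<beta>\<^sup>2 * (\<Lambda> / u0)" using u0 by (simp add: field_simps)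
  also have "\<dots> \<le> \<beta>\<^sup>2 * a" using a by (intro mult_left_mono) auto
  finally have b: "b \<le> \<beta>\<^sup>2 * a" .
  have "- (\<Sum>i\<in>UNIV. w i \<bullet> (M i *v e i)) \<le> \<beta> / 2 * a + b / (2 * \<beta>)"
    unfolding a_def b_def sum_negf[symmetric] sum_distrib_left sum_divide_distrib sum.distrib[symmetric]
    by (intro sum_mono loewner_young[OF facts] \<beta>)
  also have "b / (2 * \<beta>) \<le> \<beta>\<^sup>2 * a / (2 * \<beta>)" using b \<beta>(1) by (intro divide_right_mono) auto
  also have "\<beta>\<^sup>2 * a / (2 * \<beta>) = \<beta> / 2 * a" using \<beta>(1) by (simp add: power2_eq_square)
  finally have cross: "- (\<Sum>i\<in>UNIV. w i \<bullet> (M i *v e i)) \<le> \<beta> * a" by simp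
  have "\<eta> $ i \<bullet> v $ i = - \<alpha> * (w i \<bullet> (M i *v w i)) - w i \<bullet> (M i *v e i)" for i
  proof -
    have "\<eta> $ i \<bullet> v $ i = - \<alpha> * (\<eta> $ i \<bullet> w i) - \<eta> $ i \<bullet> e i"
      by (simp add: vi inner_diff_right inner_add_right)
    also have "\<eta> $ i \<bullet> w i = w i \<bullet> (M i *v w i)" by (simp add: Mw inner_commute)
    also have "\<eta> $ i \<bullet> e i = w i \<bullet> (M i *v e i)"
      using loewner_symmetric[OF facts, of "e i" i "w i"] by (simp add: Mw inner_commute)
    finally show ?thesis .
  qed
  then have "\<eta> \<bullet> v = - \<alpha> * a - (\<Sum>i\<in>UNIV. w i \<bullet> (M i *v e i))"
    by (simp add: inner_vec_def[of \<eta>] a_def sum_subtractf sum_negf sum_distrib_left)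
  also have "\<dots> \<le> - ((\<alpha> - \<beta>) * a)" using cross by (simp add: algebra_simps)
  also have "\<dots> \<le> - ((\<alpha> - \<beta>) * (\<Lambda> / u0))" using a \<beta>(3) by (intro le_imp_neg_le mult_left_mono) auto
  finally show ?thesis .
qed

section \<open>The tracking protocol\<close>

lemma norm_sgn_vec_le: "norm (sgn_vec x :: real^'n) \<le> real CARD('n)"
proof -
  have "norm (sgn_vec x) \<le> (\<Sum>c\<in>UNIV. \<bar>sgn_vec x $ c\<bar>)" by (rule norm_le_l1_cart)
  also have "\<dots> \<le> (\<Sum>c\<in>(UNIV::'n set). 1)" by (intro sum_mono) (simp add: sgn_vec_def abs_sgn_eq)
  finally show ?thesis by simp
qed

locale tracking_protocol = weighted_graph E A
  for E :: "('v::{finite,linorder} \<times> 'v) set"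
    and A :: "real^'v::{finite,linorder}^'v::{finite,linorder}" +
  fixes f :: "'v \<Rightarrow> real^'n \<Rightarrow> real \<Rightarrow> real"
    and g :: "'v \<Rightarrow> real^'n \<Rightarrow> real \<Rightarrow> real^'n"
    and H :: "'v \<Rightarrow> real^'n \<Rightarrow> real \<Rightarrow> real^'n^'n"
    and dg :: "'v \<Rightarrow> real^'n \<Rightarrow> real \<Rightarrow> real^'n"
    and \<theta>l \<theta>u :: "'v \<Rightarrow> real"
    and \<kappa> \<alpha> :: real
    and \<phi> :: "'v \<Rightarrow> real^'n \<Rightarrow> real^'n"
    and X Z :: "real \<Rightarrow> (real^'n)^'v::{finite,linorder}"
  assumes connected: "connected_graph E"
    and gradient: "\<And>i x t. 0 \<le> t \<Longrightarrow> GDERIV (\<lambda>y. f i y t) x :> g i x t"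
    and hessian: "\<And>i x t. 0 \<le> t \<Longrightarrow> ((\<lambda>y. g i y t) has_derivative (\<lambda>h. H i x t *v h)) (at x)"
    and hessian_cont: "\<And>i t. 0 \<le> t \<Longrightarrow> continuous_on UNIV (\<lambda>x. H i x t)"
    and theta_pos: "\<And>i. 0 < \<theta>l i" "\<And>i. 0 < \<theta>u i"
    and hessian_lower: "\<And>i x t. 0 \<le> t \<Longrightarrow> loewner_le (\<theta>l i *\<^sub>R mat 1) (H i x t)"
    and hessian_upper: "\<And>i x t. 0 \<le> t \<Longrightarrow> loewner_le (H i x t) (\<theta>u i *\<^sub>R mat 1)"
    and dg: "\<And>i x t. 0 \<le> t \<Longrightarrow> ((\<lambda>s. g i x s) has_vector_derivative dg i x t) (at t within {0..})"
    and dg_measurable: "\<And>i x. (\<lambda>t. dg i x t) \<in> borel_measurable (lebesgue_on {0..})"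
    and dg_cont: "\<And>i t. 0 \<le> t \<Longrightarrow> continuous_on UNIV (\<lambda>x. dg i x t)"
    and kappa_pos: "0 < \<kappa>"
    and dg_bound: "\<And>i x t. 0 \<le> t \<Longrightarrow> norm (dg i x t) \<le> \<kappa>"
    and phi_bounded: "\<And>i. locally_essentially_bounded (\<phi> i)"
    and alpha_pos: "0 < \<alpha>"
    and solution: "filippov_solution (protocol_rhs A \<alpha> H dg \<phi>) (\<lambda>t. (X t, Z t))"
begin

lemma auxiliary_solution: "filippov_solution (\<lambda>_ z. - \<phi> i z) (\<lambda>t. Z t $ i)"
proof -
  have "filippov_solution (\<lambda>_ z. - \<phi> i z) (\<lambda>t. snd (X t, Z t) $ i)"
  proof (rule filippov_solution_linear_image[where L = "\<lambda>w. snd w $ i" and R = "\<lambda>s. (0, axis i s)"])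
    show "linear (\<lambda>w :: ((real^'n)^'v::{finite,linorder}) \<times> ((real^'n)^'v::{finite,linorder}). snd w $ i)" by (simp add: linear_iff)
    show "norm (snd w $ i) \<le> norm w" for w :: "((real^'n)^'v::{finite,linorder}) \<times> ((real^'n)^'v::{finite,linorder})"
      by (metis Finite_Cartesian_Product.norm_nth_le norm_snd_le order_trans prod.collapse)
    show "snd (protocol_rhs A \<alpha> H dg \<phi> t w) $ i = - \<phi> i (snd w $ i)" for t w
      by (cases w) (simp add: protocol_rhs_def)
    show "filippov_solution (protocol_rhs A \<alpha> H dg \<phi>) (\<lambda>t. (X t, Z t))" by (rule solution)
  qed simp
  then show ?thesis by simp
qed

text \<open>With finitely many agents the radii have a positive minimum, and each exceptional set
  pulls back to a null set of the joint space, where the Filippov map discards null sets.\<close>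

lemma phi_locally_bounded:
  fixes x z :: "(real^'n)^'v::{finite,linorder}"
  obtains \<delta> S C where "0 < \<delta>" "negligible S" "0 \<le> C"
    "\<And>w i. w \<in> ball (x, z) \<delta> \<Longrightarrow> w \<notin> S \<Longrightarrow> norm (\<phi> i (snd w $ i)) \<le> (C :: real)"
proof -
  have "\<forall>i. \<exists>r C S. 0 < r \<and> negligible S \<and> (\<forall>w\<in>ball (z $ i) r - S. norm (\<phi> i w) \<le> C)"
    using phi_bounded unfolding locally_essentially_bounded_def by blast
  then obtain r C S where r: "\<And>i. 0 < r i" and S: "\<And>i. negligible (S i)"
    and C: "\<And>i w. w \<in> ball (z $ i) (r i) \<Longrightarrow> w \<notin> S i \<Longrightarrow> norm (\<phi> i w) \<le> C i"
    by (metis DiffI)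
  let ?L = "\<lambda>i w. snd (w :: ((real^'n)^'v::{finite,linorder}) \<times> ((real^'n)^'v::{finite,linorder})) $ i"
  show ?thesis
  proof (rule that)
    show "0 < Min (range r)" using r by (simp add: Min_gr_iff)
    have "negligible (?L i -` S i)" for i
      by (rule negligible_linear_preimage[where R = "\<lambda>s. (0, axis i s)"]) (auto simp: linear_iff S)
    then show "negligible (\<Union>i. ?L i -` S i)"
      by (intro negligible_Union finite_imageI finite) (elim imageE, simp only:)
    show "0 \<le> (\<Sum>i\<in>UNIV. \<bar>C i\<bar>)" by (intro sum_nonneg) auto
    fix w i assume w: "w \<in> ball (x, z) (Min (range r))" "w \<notin> (\<Union>i. ?L i -` S i)"
    have "dist (z $ i) (snd w $ i) \<le> dist z (snd w)" by (rule dist_vec_nth_le)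
    also have "\<dots> \<le> dist (x, z) w" using dist_snd_le[of "(x, z)" w] by simp
    also have "\<dots> < Min (range r)" using w(1) by simp
    also have "\<dots> \<le> r i" by (intro Min_le) auto
    finally have "norm (\<phi> i (snd w $ i)) \<le> C i" using w(2) by (intro C) auto
    also have "\<dots> \<le> \<bar>C i\<bar>" by simp
    also have "\<dots> \<le> (\<Sum>i\<in>UNIV. \<bar>C i\<bar>)" by (intro member_le_sum) auto
    finally show "norm (\<phi> i (snd w $ i)) \<le> (\<Sum>i\<in>UNIV. \<bar>C i\<bar>)" .
  qed
qed

section \<open>Filippov velocities and subgradients of the disagreement\<close>

lemma norm_coupling_le: "norm (coupling A x $ i) \<le> (\<Sum>j\<in>UNIV. A $ i $ j) * real CARD('n)"
  for x :: "(real^'n)^'v::{finite,linorder}"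
proof -
  have "norm (coupling A x $ i) \<le> (\<Sum>j\<in>UNIV. norm (A $ i $ j *\<^sub>R sgn_vec (x $ i - x $ j)))"
    unfolding coupling_def vec_lambda_beta by (rule norm_sum)
  also have "\<dots> \<le> (\<Sum>j\<in>UNIV. A $ i $ j * real CARD('n))"
    by (intro sum_mono) (simp add: weight_nonneg norm_sgn_vec_le mult_left_mono)
  finally show ?thesis by (simp add: sum_distrib_right)
qed

text \<open>The protocol solved for its coupling term, which is \<open>\<alpha> \<eta>\<close> in
  the overview. The velocity of \<open>z\<close> stands in for \<open>- \<phi>\<close>, and
  multiplying by \<open>H\<close> avoids the inverse.\<close>

definition feedback :: "real \<Rightarrow> ((real^'n)^'v::{finite,linorder}) \<Rightarrow> ((real^'n)^'v::{finite,linorder}) \<times> ((real^'n)^'v::{finite,linorder}) \<Rightarrow> ((real^'n)^'v::{finite,linorder})" where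
  "feedback t x v = (\<chi> i. snd v $ i - H i (x $ i) t *v (fst v $ i) - dg i (x $ i) t)"

text \<open>Freezing \<open>H\<close> and \<open>dg\<close> at \<open>x\<close> makes \<open>feedback t x\<close> affine; on the vector field at a nearby
  point it equals \<open>\<alpha> *\<^sub>R coupling\<close> up to an error that the continuity of \<open>H\<close> and \<open>dg\<close> makes small.\<close>

lemma feedback_inner_le:
  assumes v: "v \<in> filippov_map (protocol_rhs A \<alpha> H dg \<phi>) t (x, z)" and t: "0 \<le> t"
    and m: "\<And>\<epsilon>. 0 < \<epsilon> \<Longrightarrow> \<exists>\<delta>>0. \<forall>x'. dist x x' < \<delta> \<longrightarrow> \<alpha> * (coupling A x' \<bullet> Y) \<le> m + \<epsilon>"
  shows "feedback t x v \<bullet> Y \<le> m"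
proof (rule field_le_epsilon)
  fix \<epsilon> :: real assume "0 < \<epsilon>"
  obtain \<delta>0 S C where \<delta>0: "0 < \<delta>0" and S: "negligible S" and C: "0 \<le> C"
    "\<And>w i. w \<in> ball (x, z) \<delta>0 \<Longrightarrow> w \<notin> S \<Longrightarrow> norm (\<phi> i (snd w $ i)) \<le> C"
    using phi_locally_bounded[of x z] by metis
  \<comment> \<open>The speed of agent \<open>i\<close> near \<open>(x, z)\<close> off the null set:
    the norms of the three terms of the protocol, divided by the lower Hessian bound.\<close>
  define R where "R = (\<lambda>i. (C + \<kappa> + \<alpha> * ((\<Sum>j\<in>UNIV. A $ i $ j) * real CARD('n))) / \<theta>l i)"
  have R: "0 \<le> R i" for i
    unfolding R_def using C(1) kappa_pos alpha_pos theta_pos(1)[of i]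
    by (intro divide_nonneg_pos add_nonneg_nonneg mult_nonneg_nonneg sum_nonneg weight_nonneg) auto
  define K where "K = (\<Sum>i\<in>UNIV. (real CARD('n) * R i + 1) * norm (Y $ i))"
  have K: "0 \<le> K" unfolding K_def using R by (intro sum_nonneg mult_nonneg_nonneg add_nonneg_nonneg) auto
  define \<epsilon>' where "\<epsilon>' = \<epsilon> / (2 * (K + 1))"
  have \<epsilon>': "0 < \<epsilon>'" using \<open>0 < \<epsilon>\<close> K by (simp add: \<epsilon>'_def)
  have "\<exists>\<delta>>0. \<forall>y. dist y (x $ i) < \<delta> \<longrightarrow>
      norm (H i y t - H i (x $ i) t) \<le> \<epsilon>' \<and> norm (dg i y t - dg i (x $ i) t) \<le> \<epsilon>'" for i
  proof -
    obtain \<delta>1 where \<delta>1: "0 < \<delta>1" "\<And>y. dist y (x $ i) < \<delta>1 \<Longrightarrow> dist (H i y t) (H i (x $ i) t) < \<epsilon>'"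
      using hessian_cont[OF t, of i] \<epsilon>' unfolding continuous_on_iff by (metis UNIV_I)
    obtain \<delta>2 where \<delta>2: "0 < \<delta>2" "\<And>y. dist y (x $ i) < \<delta>2 \<Longrightarrow> dist (dg i y t) (dg i (x $ i) t) < \<epsilon>'"
      using dg_cont[OF t, of i] \<epsilon>' unfolding continuous_on_iff by (metis UNIV_I)
    show ?thesis
      using \<delta>1 \<delta>2 by (intro exI[of _ "min \<delta>1 \<delta>2"]) (auto simp: dist_norm less_imp_le)
  qed
  then obtain d where d: "\<And>i. 0 < d i" "\<And>i y. dist y (x $ i) < d i \<Longrightarrow> norm (H i y t - H i (x $ i) t) \<le> \<epsilon>'"
    "\<And>i y. dist y (x $ i) < d i \<Longrightarrow> norm (dg i y t - dg i (x $ i) t) \<le> \<epsilon>'"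
    by metis
  obtain \<delta>3 where \<delta>3: "0 < \<delta>3" "\<And>x'. dist x x' < \<delta>3 \<Longrightarrow> \<alpha> * (coupling A x' \<bullet> Y) \<le> m + \<epsilon> / 2"
    using m[of "\<epsilon> / 2"] \<open>0 < \<epsilon>\<close> by auto
  define \<delta> where "\<delta> = min \<delta>0 (min \<delta>3 (Min (range d)))"
  have "0 < \<delta>" using \<delta>0 \<delta>3(1) d(1) by (simp add: \<delta>_def Min_gr_iff)
  define \<Lambda> where "\<Lambda> = (\<lambda>v :: ((real^'n)^'v::{finite,linorder}) \<times> ((real^'n)^'v::{finite,linorder}).
    \<Sum>i\<in>UNIV. (snd v $ i - H i (x $ i) t *v (fst v $ i)) \<bullet> (Y $ i))"
  have lin: "linear \<Lambda>"
    unfolding \<Lambda>_def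
    by (rule linearI)
      (simp_all add: matrix_vector_right_distrib matrix_vector_mult_scaleR inner_diff_left inner_add_left
        sum.distrib sum_subtractf sum_distrib_left algebra_simps)
  define c where "c = (\<Sum>i\<in>UNIV. dg i (x $ i) t \<bullet> (Y $ i))"
  have fb: "feedback t x u \<bullet> Y = \<Lambda> u - c" for u
    by (simp add: feedback_def inner_vec_def[of _ Y] \<Lambda>_def c_def inner_diff_left flip: sum_subtractf)
  have "v \<in> {u. \<Lambda> u \<le> m + \<epsilon> + c}"
  proof (rule filippov_map_subset[OF v \<open>0 < \<delta>\<close> S])
    have "continuous_on UNIV \<Lambda>"
      using lin by (intro linear_continuous_on) (simp add: linear_conv_bounded_linear)
    then show "closed {u. \<Lambda> u \<le> m + \<epsilon> + c}" by (intro closed_Collect_le continuous_on_const)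
    have "convex (\<Lambda> -` {..m + \<epsilon> + c})" by (intro convex_linear_vimage lin convex_real_interval)
    then show "convex {u. \<Lambda> u \<le> m + \<epsilon> + c}" by (simp add: vimage_def)
    fix w assume w: "w \<in> ball (x, z) \<delta>" "w \<notin> S"
    obtain x' z' where w': "w = (x', z')" by (cases w)
    have xx': "dist x x' < \<delta>"
      using w(1) dist_fst_le[of "(x, z)" w] by (simp add: w')
    define u where "u = protocol_rhs A \<alpha> H dg \<phi> t w"
    have Hu: "H i (x' $ i) t *v (fst u $ i) = - (\<phi> i (z' $ i) + dg i (x' $ i) t + \<alpha> *\<^sub>R coupling A x' $ i)"
      and snd_u: "snd u $ i = - \<phi> i (z' $ i)" for i
    proof -
      have "H i (x' $ i) t *v (matrix_inv (H i (x' $ i) t) *v y) = y" for y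
        by (rule loewner_mult_inv[OF hessian_lower[OF t] hessian_upper[OF t] theta_pos])
      then show "H i (x' $ i) t *v (fst u $ i) = - (\<phi> i (z' $ i) + dg i (x' $ i) t + \<alpha> *\<^sub>R coupling A x' $ i)"
        by (simp add: u_def w' protocol_rhs_def coupling_def linear_neg[OF matrix_vector_mul_linear])
      show "snd u $ i = - \<phi> i (z' $ i)" by (simp add: u_def w' protocol_rhs_def)
    qed
    have nu: "norm (fst u $ i) \<le> R i" for i
    proof -
      have "\<theta>l i * norm (fst u $ i) \<le> norm (H i (x' $ i) t *v (fst u $ i))"
        by (rule loewner_norm_lower[OF hessian_lower[OF t] hessian_upper[OF t] theta_pos])
      also have "\<dots> \<le> norm (\<phi> i (z' $ i)) + norm (dg i (x' $ i) t) + norm (\<alpha> *\<^sub>R coupling A x' $ i)"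
        unfolding Hu norm_minus_cancel by (meson norm_triangle_ineq order_trans add_right_mono)
      also have "\<dots> \<le> C + \<kappa> + \<alpha> * ((\<Sum>j\<in>UNIV. A $ i $ j) * real CARD('n))"
        using C(2)[of w i] w dg_bound[OF t, of i "x' $ i"] norm_coupling_le[of x' i] alpha_pos
        by (intro add_mono) (auto simp: w' \<delta>_def)
      finally show ?thesis using theta_pos(1)[of i] by (simp add: R_def field_simps)
    qed
    have "(snd u $ i - H i (x $ i) t *v (fst u $ i)) \<bullet> (Y $ i) - dg i (x $ i) t \<bullet> (Y $ i) \<le>
        \<alpha> * (coupling A x' $ i \<bullet> Y $ i) + \<epsilon>' * ((real CARD('n) * R i + 1) * norm (Y $ i))" for i
    proof -
      have "dist (x' $ i) (x $ i) \<le> dist x x'"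
        by (metis dist_commute dist_vec_nth_le)
      also have "\<dots> < Min (range d)" using xx' by (simp add: \<delta>_def)
      also have "\<dots> \<le> d i" by (intro Min_le) auto
      finally have di: "dist (x' $ i) (x $ i) < d i" .
      let ?e = "(H i (x' $ i) t - H i (x $ i) t) *v (fst u $ i) + (dg i (x' $ i) t - dg i (x $ i) t)"
      have "snd u $ i - H i (x $ i) t *v (fst u $ i) - dg i (x $ i) t = \<alpha> *\<^sub>R coupling A x' $ i + ?e"
        \<comment> \<open>The values of \<open>\<phi>\<close> cancel here; what is left besides the
          coupling is the change of \<open>H\<close> and \<open>dg\<close> between \<open>x\<close>
          and \<open>x'\<close>.\<close>
        unfolding matrix_vector_mult_diff_rdistrib Hu snd_u by simp
      then have "(snd u $ i - H i (x $ i) t *v (fst u $ i)) \<bullet> (Y $ i) - dg i (x $ i) t \<bullet> (Y $ i) =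
          (\<alpha> *\<^sub>R coupling A x' $ i + ?e) \<bullet> (Y $ i)"
        unfolding inner_diff_left[of "snd u $ i - H i (x $ i) t *v (fst u $ i)", symmetric] by (rule arg_cong)
      also have "\<dots> = \<alpha> * (coupling A x' $ i \<bullet> Y $ i) + ?e \<bullet> Y $ i"
        unfolding inner_add_left[of "\<alpha> *\<^sub>R coupling A x' $ i" ?e] inner_scaleR_left ..
      finally have "(snd u $ i - H i (x $ i) t *v (fst u $ i)) \<bullet> (Y $ i) - dg i (x $ i) t \<bullet> (Y $ i) =
          \<alpha> * (coupling A x' $ i \<bullet> Y $ i) + ?e \<bullet> Y $ i" .
      moreover have "?e \<bullet> Y $ i \<le> norm ?e * norm (Y $ i)" by (rule norm_cauchy_schwarz)
      moreover have "norm ?e \<le> \<epsilon>' * (real CARD('n) * R i + 1)"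
      proof -
        have "norm ((H i (x' $ i) t - H i (x $ i) t) *v (fst u $ i)) \<le>
            real CARD('n) * norm (H i (x' $ i) t - H i (x $ i) t) * norm (fst u $ i)"
          by (rule norm_matrix_vector_mult_le)
        also have "\<dots> \<le> real CARD('n) * \<epsilon>' * R i"
          using d(2)[OF di] nu \<epsilon>' by (intro mult_mono mult_nonneg_nonneg) auto
        finally have "norm ?e \<le> real CARD('n) * \<epsilon>' * R i + \<epsilon>'"
          using d(3)[OF di] norm_triangle_ineq order_trans add_mono by meson
        then show ?thesis by (simp add: algebra_simps)
      qed
      then have "norm ?e * norm (Y $ i) \<le> \<epsilon>' * ((real CARD('n) * R i + 1) * norm (Y $ i))"
        by (simp add: mult_right_mono flip: mult.assoc)
      ultimately show ?thesis by linarith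
    qed
    then have "(\<Sum>i\<in>UNIV. (snd u $ i - H i (x $ i) t *v (fst u $ i)) \<bullet> (Y $ i) - dg i (x $ i) t \<bullet> (Y $ i)) \<le>
        (\<Sum>i\<in>UNIV. \<alpha> * (coupling A x' $ i \<bullet> Y $ i) + \<epsilon>' * ((real CARD('n) * R i + 1) * norm (Y $ i)))"
      by (rule sum_mono)
    then have "\<Lambda> u - c \<le> \<alpha> * (coupling A x' \<bullet> Y) + \<epsilon>' * K"
      by (simp add: \<Lambda>_def c_def K_def sum_subtractf sum.distrib inner_vec_def[of _ Y] flip: sum_distrib_left)
    also have "\<alpha> * (coupling A x' \<bullet> Y) \<le> m + \<epsilon> / 2" using \<delta>3(2) xx' by (simp add: \<delta>_def)
    also have "\<epsilon>' * K \<le> \<epsilon> / 2" using K \<open>0 < \<epsilon>\<close> by (simp add: \<epsilon>'_def field_simps)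
    finally show "protocol_rhs A \<alpha> H dg \<phi> t w \<in> {u. \<Lambda> u \<le> m + \<epsilon> + c}" by (simp add: u_def)
  qed
  then show "feedback t x v \<bullet> Y \<le> m + \<epsilon>" by (simp add: fb)
qed

lemma feedback_le_disagreement:
  assumes "v \<in> filippov_map (protocol_rhs A \<alpha> H dg \<phi>) t (x, z)" "0 \<le> t"
  shows "feedback t x v \<bullet> Y \<le> \<alpha> * disagreement A Y"
  using assms
proof (rule feedback_inner_le)
  fix \<epsilon> :: real assume "0 < \<epsilon>"
  have "\<alpha> * (coupling A x' \<bullet> Y) \<le> \<alpha> * disagreement A Y + \<epsilon>" for x'
    using mult_left_mono[OF coupling_inner_le[of x' Y], of \<alpha>] alpha_pos \<open>0 < \<epsilon>\<close> by linarith
  then show "\<exists>\<delta>>0. \<forall>x'. dist x x' < \<delta> \<longrightarrow> \<alpha> * (coupling A x' \<bullet> Y) \<le> \<alpha> * disagreement A Y + \<epsilon>"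
    by (intro exI[of _ 1]) auto
qed

text \<open>The coupling at \<open>x'\<close> attains the disagreement at \<open>x'\<close>, not at
  \<open>x\<close>. Passing to \<open>x\<close> costs the disagreement of \<open>x' - x\<close>
  twice, once in the pairing and once in comparing the two values, and both vanish in the
  limit.\<close>

lemma feedback_ge_disagreement:
  assumes "v \<in> filippov_map (protocol_rhs A \<alpha> H dg \<phi>) t (x, z)" "0 \<le> t"
  shows "\<alpha> * disagreement A x \<le> feedback t x v \<bullet> x"
proof -
  have "feedback t x v \<bullet> (- x) \<le> - (\<alpha> * disagreement A x)"
    using assms
  proof (rule feedback_inner_le)
    fix \<epsilon> :: real assume "0 < \<epsilon>"
    have "continuous_on UNIV (\<lambda>x'. disagreement A (x' - x))"
      unfolding disagreement_def by (intro continuous_intros) auto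
    then obtain \<delta> where \<delta>: "0 < \<delta>" "\<And>x'. dist x' x < \<delta> \<Longrightarrow>
        dist (disagreement A (x' - x)) (disagreement A (x - x)) < \<epsilon> / (2 * \<alpha>)"
      using \<open>0 < \<epsilon>\<close> alpha_pos unfolding continuous_on_iff by (metis UNIV_I divide_pos_pos mult_pos_pos zero_less_numeral)
    have "\<alpha> * (coupling A x' \<bullet> (- x)) \<le> - (\<alpha> * disagreement A x) + \<epsilon>" if "dist x x' < \<delta>" for x'
    proof -
      have "disagreement A (x' - x) < \<epsilon> / (2 * \<alpha>)"
        using \<delta>(2)[of x'] that by (simp add: dist_commute dist_real_def disagreement_def)
      then have small: "\<alpha> * (2 * disagreement A (x' - x)) \<le> \<epsilon>"
        using alpha_pos by (simp add: field_simps)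
      have "coupling A x' \<bullet> (- x) = coupling A x' \<bullet> (x' - x) - coupling A x' \<bullet> x'"
        by (simp add: inner_diff_right)
      also have "\<dots> \<le> disagreement A (x' - x) - disagreement A x'"
        using coupling_inner_le[of x' "x' - x"] coupling_inner_self[of x'] by linarith
      also have "\<dots> \<le> 2 * disagreement A (x' - x) - disagreement A x"
        using disagreement_add[of x' "x - x'"] disagreement_minus_commute[of x x'] by simp
      finally have "\<alpha> * (coupling A x' \<bullet> (- x)) \<le> \<alpha> * (2 * disagreement A (x' - x) - disagreement A x)"
        using alpha_pos by (intro mult_left_mono) auto
      then show ?thesis using small by (simp add: right_diff_distrib)
    qed
    then show "\<exists>\<delta>>0. \<forall>x'. dist x x' < \<delta> \<longrightarrow> \<alpha> * (coupling A x' \<bullet> (- x)) \<le> - (\<alpha> * disagreement A x) + \<epsilon>"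
      using \<delta>(1) by blast
  qed
  then show ?thesis by simp
qed

text \<open>The disagreement vanishes on constant tuples; testing against the constant tuple formed
  by the sum itself bounds its squared norm by 0.\<close>

lemma sum_feedback:
  assumes "v \<in> filippov_map (protocol_rhs A \<alpha> H dg \<phi>) t (x, z)" "0 \<le> t"
  shows "(\<Sum>i\<in>UNIV. feedback t x v $ i) = 0"
proof -
  let ?s = "\<Sum>i\<in>UNIV. feedback t x v $ i"
  have "feedback t x v \<bullet> (\<chi> i. ?s) \<le> 0"
    using feedback_le_disagreement[OF assms, of "\<chi> i. ?s"] by (simp add: disagreement_const)
  then have "?s \<bullet> ?s \<le> 0" by (simp add: inner_vec_def[of "feedback t x v"] inner_sum_left)
  then show ?thesis by (metis inner_ge_zero inner_eq_zero_iff order_antisym)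
qed

section \<open>Derivatives and absolute continuity along the trajectory\<close>

lemma ac_state: "0 \<le> a \<Longrightarrow> a \<le> b \<Longrightarrow> absolutely_continuous_fun a b (\<lambda>t. (X t, Z t))"
  using solution unfolding filippov_solution_def
  by (meson absolutely_continuous_fun_subset order_trans)

lemma inclusion_ae:
  obtains N where "negligible N" "\<And>t. t \<notin> N \<Longrightarrow> 0 \<le> t \<Longrightarrow>
    \<exists>v. v \<in> filippov_map (protocol_rhs A \<alpha> H dg \<phi>) t (X t, Z t) \<and>
      ((\<lambda>t. (X t, Z t)) has_vector_derivative v) (at t)"
proof -
  have "AE t in lebesgue. 0 \<le> t \<longrightarrow> (\<exists>v\<in>filippov_map (protocol_rhs A \<alpha> H dg \<phi>) t (X t, Z t).
      ((\<lambda>t. (X t, Z t)) has_vector_derivative v) (at t))"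
    using solution by (simp add: filippov_solution_def)
  then show ?thesis
    unfolding eventually_ae_filter_negligible using that by blast
qed

lemma state_derivative_components:
  assumes "((\<lambda>t. (X t, Z t)) has_vector_derivative v) (at t)"
  shows "(X has_vector_derivative fst v) (at t)" "((\<lambda>t. X t $ i) has_vector_derivative fst v $ i) (at t)"
    "((\<lambda>t. Z t $ i) has_vector_derivative snd v $ i) (at t)"
proof -
  show X: "(X has_vector_derivative fst v) (at t)"
    using bounded_linear.has_vector_derivative[OF bounded_linear_fst assms] by simp
  have Z: "(Z has_vector_derivative snd v) (at t)"
    using bounded_linear.has_vector_derivative[OF bounded_linear_snd assms] by simp
  show "((\<lambda>t. X t $ i) has_vector_derivative fst v $ i) (at t)"
    by (rule bounded_linear.has_vector_derivative[OF bounded_linear_vec_nth X])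
  show "((\<lambda>t. Z t $ i) has_vector_derivative snd v $ i) (at t)"
    by (rule bounded_linear.has_vector_derivative[OF bounded_linear_vec_nth Z])
qed

lemma norm_X_le: "norm (X t $ i - X s $ i) \<le> norm ((X t, Z t) - (X s, Z s))"
proof -
  have "dist (X t $ i) (X s $ i) \<le> dist (X t) (X s)" by (rule dist_vec_nth_le)
  also have "\<dots> \<le> dist (X t, Z t) (X s, Z s)" using dist_fst_le[of "(X t, Z t)" "(X s, Z s)"] by simp
  finally show ?thesis by (simp add: dist_norm)
qed

lemma norm_Z_le: "norm (Z t $ i - Z s $ i) \<le> norm ((X t, Z t) - (X s, Z s))"
proof -
  have "dist (Z t $ i) (Z s $ i) \<le> dist (Z t) (Z s)" by (rule dist_vec_nth_le)
  also have "\<dots> \<le> dist (X t, Z t) (X s, Z s)" using dist_snd_le[of "(X t, Z t)" "(X s, Z s)"] by simp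
  finally show ?thesis by (simp add: dist_norm)
qed

text \<open>The mean value inequality is applied in space at time \<open>t\<close> and then in time
  at the point \<open>y\<close>. The result has the shape required for absolute continuity along the
  trajectory.\<close>

lemma gradient_lipschitz:
  assumes "0 \<le> s" "s \<le> t"
  shows "norm (g i x t - g i y s) \<le> \<theta>u i * norm (x - y) + \<kappa> * (t - s)"
proof -
  have "0 \<le> t" using assms by simp
  have "norm (g i x t - g i y t) \<le> \<theta>u i * norm (x - y)"
  proof (rule differentiable_bound[of UNIV "\<lambda>x. g i x t"])
    show "((\<lambda>x. g i x t) has_derivative (\<lambda>h. H i x t *v h)) (at x within UNIV)" for x
      using hessian[OF \<open>0 \<le> t\<close>] by simp
    show "onorm (\<lambda>h. H i x t *v h) \<le> \<theta>u i" for x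
      using loewner_norm_upper[OF hessian_lower[OF \<open>0 \<le> t\<close>] hessian_upper[OF \<open>0 \<le> t\<close>] theta_pos] theta_pos(2)[of i]
      by (intro onorm_bound) auto
  qed auto
  moreover have "norm (g i y t - g i y s) \<le> \<kappa> * norm (t - s)"
  proof (rule differentiable_bound[of "{0..}" "\<lambda>t. g i y t"])
    show "((\<lambda>t. g i y t) has_derivative (\<lambda>h. h *\<^sub>R dg i y r)) (at r within {0..})" if "r \<in> {0..}" for r
      using dg[of r i y] that by (simp add: has_vector_derivative_def)
    show "onorm (\<lambda>h. h *\<^sub>R dg i y r) \<le> \<kappa>" if "r \<in> {0..}" for r
      using dg_bound[of r i y] that kappa_pos
      by (intro onorm_bound) (auto simp: mult.commute[of \<kappa>] intro: mult_left_mono)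
  qed (use assms in auto)
  ultimately show ?thesis
    using norm_triangle_ineq[of "g i x t - g i y t" "g i y t - g i y s"] assms by simp
qed

text \<open>One null set serves all agents, there being finitely many. Time 0 is excluded because
  the derivative of \<open>g\<close> in time is one-sided there.\<close>

lemma gradient_derivative_ae:
  obtains N where "negligible N" "\<And>t v i. 0 < t \<Longrightarrow> t \<notin> N \<Longrightarrow>
    ((\<lambda>t. (X t, Z t)) has_vector_derivative v) (at t) \<Longrightarrow>
    ((\<lambda>s. g i (X s $ i) s) has_vector_derivative (H i (X t $ i) t *v (fst v $ i) + dg i (X t $ i) t)) (at t)"
proof -
  have "\<exists>N. negligible N \<and> (\<forall>t x \<epsilon>. 0 < t \<and> t \<notin> N \<and> 0 < \<epsilon> \<longrightarrow>
    (\<exists>d>0. \<forall>y s. dist y x < d \<and> dist s t < d \<longrightarrow>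
      norm ((g i y s - g i y t) - (g i x s - g i x t)) \<le> \<epsilon> * \<bar>s - t\<bar>))" for i
    by (rule time_increment_uniform[of "g i" "dg i" \<kappa>])
      (use dg dg_measurable dg_cont dg_bound in blast)+
  then obtain N where N: "\<And>i. negligible (N i)" and incr: "\<And>i t x \<epsilon>. 0 < t \<Longrightarrow> t \<notin> N i \<Longrightarrow> 0 < \<epsilon> \<Longrightarrow>
    (\<exists>d>0. \<forall>y s. dist y x < d \<and> dist s t < d \<longrightarrow>
      norm ((g i y s - g i y t) - (g i x s - g i x t)) \<le> \<epsilon> * \<bar>s - t\<bar>)"
    by metis
  show ?thesis
  proof (rule that)
    show "negligible (\<Union>i. N i)"
      using N by (intro negligible_Union finite_imageI finite) (elim imageE, simp only:)
    fix t v i assume t: "0 < t" "t \<notin> (\<Union>i. N i)" and v: "((\<lambda>t. (X t, Z t)) has_vector_derivative v) (at t)"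
    show "((\<lambda>s. g i (X s $ i) s) has_vector_derivative (H i (X t $ i) t *v (fst v $ i) + dg i (X t $ i) t)) (at t)"
    proof (rule has_vector_derivative_along[OF state_derivative_components(2)[OF v]])
      show "((\<lambda>y. g i y t) has_derivative (\<lambda>h. H i (X t $ i) t *v h)) (at (X t $ i))"
        using hessian t(1) by simp
      have "at t within {0..} = at t"
        using t(1) by (intro at_within_interior) (simp add: interior_real_atLeast)
      then show "((\<lambda>s. g i (X t $ i) s) has_vector_derivative dg i (X t $ i) t) (at t)"
        using dg[of t i "X t $ i"] t(1) by simp
      show "\<exists>d>0. \<forall>y s. dist y (X t $ i) < d \<and> dist s t < d \<longrightarrow>
        norm ((g i y s - g i y t) - (g i (X t $ i) s - g i (X t $ i) t)) \<le> \<epsilon> * \<bar>s - t\<bar>" if "0 < \<epsilon>" for \<epsilon>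
        using t that by (intro incr) auto
    qed
  qed
qed

text \<open>Each summand has derivative equal to minus its component of \<open>feedback\<close>, so
  the total derivative vanishes almost everywhere; absolute continuity turns this into constancy.
  This holds before the auxiliary variables have settled.\<close>

lemma sum_gradient_minus_auxiliary_const:
  assumes "0 \<le> b"
  shows "(\<Sum>i\<in>UNIV. g i (X b $ i) b - Z b $ i) = (\<Sum>i\<in>UNIV. g i (X 0 $ i) 0 - Z 0 $ i)"
proof -
  define D where "D = (\<lambda>t. \<Sum>i\<in>UNIV. g i (X t $ i) t - Z t $ i)"
  obtain N1 where N1: "negligible N1" "\<And>t. t \<notin> N1 \<Longrightarrow> 0 \<le> t \<Longrightarrow>
    \<exists>v. v \<in> filippov_map (protocol_rhs A \<alpha> H dg \<phi>) t (X t, Z t) \<and>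
      ((\<lambda>t. (X t, Z t)) has_vector_derivative v) (at t)"
    by (rule inclusion_ae) blast
  obtain N2 where N2: "negligible N2" "\<And>t v i. 0 < t \<Longrightarrow> t \<notin> N2 \<Longrightarrow>
    ((\<lambda>t. (X t, Z t)) has_vector_derivative v) (at t) \<Longrightarrow>
    ((\<lambda>s. g i (X s $ i) s) has_vector_derivative (H i (X t $ i) t *v (fst v $ i) + dg i (X t $ i) t)) (at t)"
    by (rule gradient_derivative_ae) blast
  have D': "(D has_vector_derivative 0) (at t)" if t: "0 < t" "t \<notin> N1" "t \<notin> N2" for t
  proof -
    obtain v where v: "v \<in> filippov_map (protocol_rhs A \<alpha> H dg \<phi>) t (X t, Z t)"
      "((\<lambda>t. (X t, Z t)) has_vector_derivative v) (at t)"
      using N1(2) t by fastforce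
    have "(D has_vector_derivative (\<Sum>i\<in>UNIV. (H i (X t $ i) t *v (fst v $ i) + dg i (X t $ i) t) - snd v $ i)) (at t)"
      unfolding D_def
      by (intro has_vector_derivative_sum has_vector_derivative_diff N2(2)[OF t(1,3) v(2)]
        state_derivative_components(3)[OF v(2)])
    moreover have "(\<Sum>i\<in>UNIV. (H i (X t $ i) t *v (fst v $ i) + dg i (X t $ i) t) - snd v $ i) =
        - (\<Sum>i\<in>UNIV. feedback t (X t) v $ i)"
      unfolding sum_negf[symmetric] by (intro sum.cong refl) (simp add: feedback_def)
    ultimately show ?thesis using sum_feedback[OF v(1)] t(1) by simp
  qed
  \<comment> \<open>The derivative estimate is scalar and one-sided; applying it to both
    \<open>c\<close> and \<open>- c\<close> gives equality in every direction.\<close>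
  have le: "D b \<bullet> c \<le> D 0 \<bullet> c" for c
  proof -
    have "absolutely_continuous_fun 0 b (\<lambda>t. D t \<bullet> c)"
    proof (rule absolutely_continuous_fun_dominated[OF ac_state[OF order_refl assms]])
      show "0 \<le> (\<Sum>i\<in>UNIV. \<theta>u i + 1) * norm c" "0 \<le> (\<Sum>i\<in>(UNIV::'v set). \<kappa>) * norm c"
        by (intro mult_nonneg_nonneg sum_nonneg add_nonneg_nonneg norm_ge_zero zero_le_one
          less_imp_le[OF theta_pos(2)] less_imp_le[OF kappa_pos])+
      fix s t :: real assume st: "0 \<le> s" "s \<le> t"
      let ?P = "norm ((X t, Z t) - (X s, Z s))"
      have "D t - D s = (\<Sum>i\<in>UNIV. (g i (X t $ i) t - g i (X s $ i) s) - (Z t $ i - Z s $ i))"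
        unfolding D_def sum_subtractf[symmetric] by (intro sum.cong refl) simp
      then have "norm (D t - D s) \<le> (\<Sum>i\<in>UNIV. norm ((g i (X t $ i) t - g i (X s $ i) s) - (Z t $ i - Z s $ i)))"
        by (simp only: norm_sum)
      also have "\<dots> \<le> (\<Sum>i\<in>UNIV. (\<theta>u i + 1) * ?P + \<kappa> * (t - s))"
      proof (rule sum_mono)
        fix i
        have "norm ((g i (X t $ i) t - g i (X s $ i) s) - (Z t $ i - Z s $ i)) \<le>
            norm (g i (X t $ i) t - g i (X s $ i) s) + norm (Z t $ i - Z s $ i)"
          by (rule norm_triangle_ineq4)
        also have "\<dots> \<le> (\<theta>u i * norm (X t $ i - X s $ i) + \<kappa> * (t - s)) + ?P"
          by (intro add_mono gradient_lipschitz[OF st] norm_Z_le)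
        also have "\<theta>u i * norm (X t $ i - X s $ i) \<le> \<theta>u i * ?P"
          using theta_pos(2)[of i] by (intro mult_left_mono norm_X_le) auto
        finally show "norm ((g i (X t $ i) t - g i (X s $ i) s) - (Z t $ i - Z s $ i)) \<le> (\<theta>u i + 1) * ?P + \<kappa> * (t - s)"
          by (simp add: distrib_right)
      qed
      also have "\<dots> = (\<Sum>i\<in>UNIV. \<theta>u i + 1) * ?P + (\<Sum>i\<in>(UNIV::'v set). \<kappa>) * (t - s)"
        unfolding sum_distrib_right by (rule sum.distrib)
      finally have D_le: "norm (D t - D s) \<le> (\<Sum>i\<in>UNIV. \<theta>u i + 1) * ?P + (\<Sum>i\<in>(UNIV::'v set). \<kappa>) * (t - s)" .
      have "norm (D t \<bullet> c - D s \<bullet> c) \<le> norm (D t - D s) * norm c"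
        by (simp add: Cauchy_Schwarz_ineq2 flip: inner_diff_left)
      also have "\<dots> \<le> ((\<Sum>i\<in>UNIV. \<theta>u i + 1) * ?P + (\<Sum>i\<in>(UNIV::'v set). \<kappa>) * (t - s)) * norm c"
        by (intro mult_right_mono D_le) auto
      finally show "norm (D t \<bullet> c - D s \<bullet> c) \<le>
          (\<Sum>i\<in>UNIV. \<theta>u i + 1) * norm c * ?P + (\<Sum>i\<in>(UNIV::'v set). \<kappa>) * norm c * (t - s)"
        by (simp add: algebra_simps)
    qed
    then have "D b \<bullet> c - D 0 \<bullet> c \<le> 0 * (b - 0)"
    proof (rule absolutely_continuous_fun_deriv_le[OF _ assms])
      show "negligible (insert 0 (N1 \<union> N2))" using N1(1) N2(1) by (simp add: negligible_Un)
      fix t :: real assume "0 \<le> t" "t \<notin> insert 0 (N1 \<union> N2)"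
      then have "(D has_vector_derivative 0) (at t)" by (intro D') auto
      from bounded_linear.has_vector_derivative[OF bounded_linear_inner_left this, of c]
      have "((\<lambda>t. D t \<bullet> c) has_real_derivative 0) (at t)"
        by (simp add: has_real_derivative_iff_has_vector_derivative)
      then show "\<exists>D'\<le>0. ((\<lambda>t. D t \<bullet> c) has_real_derivative D') (at t)" by blast
    qed
    then show ?thesis by simp
  qed
  have "D b \<bullet> c = D 0 \<bullet> c" for c using le[of c] le[of "- c"] by simp
  then have "(D b - D 0) \<bullet> (D b - D 0) = 0" by (simp add: inner_diff_left)
  then show ?thesis by (simp add: D_def)
qed

text \<open>The only kinks are times at which a coordinate difference passes through 0 with nonzero
  slope, and there are countably many of them.\<close>

lemma disagreement_differentiable_ae:
  obtains N where "negligible N" "\<And>t v. t \<notin> N \<Longrightarrow> (X has_vector_derivative v) (at t) \<Longrightarrow>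
    \<exists>D. ((\<lambda>t. disagreement A (X t)) has_real_derivative D) (at t)"
proof -
  define w where "w = (\<lambda>(i,j,c) t. X t $ i $ c - X t $ j $ c)"
  define N where "N = (\<Union>p. {t. w p t = 0 \<and> (\<exists>D. D \<noteq> 0 \<and> (w p has_real_derivative D) (at t))})"
  have "countable N"
    unfolding N_def by (intro countable_UN countable_zeros_with_nonzero_deriv) (auto intro: countable_finite)
  then have "negligible N"
    by (simp add: negligible_iff_null_sets null_sets_completionI countable_imp_null_set_lborel)
  moreover have "\<exists>D. ((\<lambda>t. disagreement A (X t)) has_real_derivative D) (at t)"
    if "t \<notin> N" "(X has_vector_derivative v) (at t)" for t v
  proof -
    have "\<exists>D. ((\<lambda>t. \<bar>w p t\<bar>) has_real_derivative D) (at t)" for p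
    proof -
      obtain i j c where p: "p = (i, j, c)" by (cases p)
      have X: "((\<lambda>t. X t $ i $ c) has_vector_derivative v $ i $ c) (at t)" for i c
        by (intro bounded_linear.has_vector_derivative[OF bounded_linear_vec_nth] that(2))
      have D: "(w p has_real_derivative (v $ i $ c - v $ j $ c)) (at t)"
        unfolding w_def p has_real_derivative_iff_has_vector_derivative
        by (simp add: has_vector_derivative_diff X)
      show ?thesis
        by (rule has_real_derivative_abs[OF D]) (use that(1) D in \<open>unfold N_def, blast\<close>)
    qed
    then obtain D where D: "\<And>p. ((\<lambda>t. \<bar>w p t\<bar>) has_real_derivative D p) (at t)" by metis
    have "((\<lambda>t. (\<Sum>i\<in>UNIV. \<Sum>j\<in>UNIV. A $ i $ j * (\<Sum>c\<in>UNIV. \<bar>w (i,j,c) t\<bar>)) / 2)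
      has_real_derivative (\<Sum>i\<in>UNIV. \<Sum>j\<in>UNIV. A $ i $ j * (\<Sum>c\<in>UNIV. D (i,j,c))) / 2) (at t)"
      by (intro DERIV_cdivide DERIV_sum DERIV_cmult D)
    then show ?thesis by (auto simp: w_def disagreement_def)
  qed
  ultimately show ?thesis using that by blast
qed

text \<open>By the subgradient inequalities the disagreement minus its linear support along the
  trajectory is minimal at \<open>t\<close>, so its derivative vanishes there. The value thus does
  not depend on which subgradient the Filippov set supplies.\<close>

lemma deriv_disagreement:
  assumes D: "((\<lambda>t. disagreement A (X t)) has_real_derivative D) (at t)"
    and X: "(X has_vector_derivative v) (at t)"
    and le: "\<And>Y. \<eta> \<bullet> Y \<le> disagreement A Y" and ge: "disagreement A (X t) \<le> \<eta> \<bullet> X t"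
  shows "D = \<eta> \<bullet> v"
proof -
  have "((\<lambda>s. \<eta> \<bullet> X s) has_real_derivative \<eta> \<bullet> v) (at t)"
    unfolding has_real_derivative_iff_has_vector_derivative
    by (rule bounded_linear.has_vector_derivative[OF bounded_linear_inner_right X])
  then have "((\<lambda>s. disagreement A (X s) - \<eta> \<bullet> X s) has_real_derivative (D - \<eta> \<bullet> v)) (at t)"
    by (intro DERIV_diff D)
  moreover have "disagreement A (X t) - \<eta> \<bullet> X t \<le> disagreement A (X s) - \<eta> \<bullet> X s" for s
    using le[of "X s"] ge by linarith
  ultimately have "D - \<eta> \<bullet> v = 0"
    by (intro DERIV_local_min[of "\<lambda>s. disagreement A (X s) - \<eta> \<bullet> X s" _ t 1]) auto
  then show ?thesis by simp
qed

lemma ac_disagreement: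
  assumes "0 \<le> a" "a \<le> b"
  shows "absolutely_continuous_fun a b (\<lambda>t. disagreement A (X t))"
proof (rule absolutely_continuous_fun_dominated[OF ac_state[OF assms]])
  let ?K = "(\<Sum>i\<in>UNIV. \<Sum>j\<in>UNIV. A $ i $ j * (\<Sum>c\<in>(UNIV::'n set). 2)) / 2"
  show "0 \<le> ?K"
    by (intro divide_nonneg_nonneg sum_nonneg mult_nonneg_nonneg weight_nonneg) auto
  fix s t :: real
  let ?P = "norm ((X t, Z t) - (X s, Z s))"
  have "disagreement A (X t - X s) \<le> (\<Sum>i\<in>UNIV. \<Sum>j\<in>UNIV. A $ i $ j * (\<Sum>c\<in>(UNIV::'n set). 2 * ?P)) / 2"
    unfolding disagreement_def
  proof (intro divide_right_mono sum_mono mult_left_mono weight_nonneg)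
    fix i j c
    have "\<bar>(X t - X s) $ i $ c\<bar> \<le> ?P" for i
      using component_le_norm_cart[of "(X t - X s) $ i" c] norm_X_le[of t i s] by simp
    from this[of i] this[of j]
    show "\<bar>(X t - X s) $ i $ c - (X t - X s) $ j $ c\<bar> \<le> 2 * ?P" by linarith
  qed simp
  also have "\<dots> = ?K * ?P"
    by (simp add: sum_distrib_left sum_distrib_right mult_ac sum_divide_distrib)
  finally have 1: "disagreement A (X t - X s) \<le> ?K * ?P" .
  have "\<bar>disagreement A (X t) - disagreement A (X s)\<bar> \<le> disagreement A (X t - X s)"
    using disagreement_add[of "X t - X s" "X s"] disagreement_add[of "X s - X t" "X t"]
      disagreement_minus_commute[of "X s" "X t"] by simp
  then show "norm (disagreement A (X t) - disagreement A (X s)) \<le> ?K * ?P + 0 * (t - s)"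
    using 1 by simp
qed simp

section \<open>Strict convexity and the optimal trajectory\<close>

lemma gradient_strict_convex:
  assumes "0 \<le> t" "y \<noteq> x"
  shows "f i x t + g i x t \<bullet> (y - x) < f i y t"
proof -
  define d where "d = y - x"
  have "d \<noteq> 0" using assms(2) by (simp add: d_def)
  have line: "((\<lambda>s. x + s *\<^sub>R d) has_derivative (\<lambda>h. h *\<^sub>R d)) (at s)" for s
    by (auto intro!: derivative_eq_intros)
  have f': "((\<lambda>s. f i (x + s *\<^sub>R d) t) has_real_derivative g i (x + s *\<^sub>R d) t \<bullet> d) (at s)" for s
  proof -
    have "((\<lambda>y. f i y t) has_derivative (\<lambda>h. h \<bullet> g i (x + s *\<^sub>R d) t)) (at (x + s *\<^sub>R d))"
      using gradient[OF assms(1)] by (simp add: gderiv_def)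
    from has_derivative_compose[OF line this]
    have "((\<lambda>s. f i (x + s *\<^sub>R d) t) has_derivative (\<lambda>h. (h *\<^sub>R d) \<bullet> g i (x + s *\<^sub>R d) t)) (at s)" .
    moreover have "(\<lambda>h. (h *\<^sub>R d) \<bullet> g i (x + s *\<^sub>R d) t) = (*) (g i (x + s *\<^sub>R d) t \<bullet> d)"
      by (auto simp: fun_eq_iff inner_commute)
    ultimately show ?thesis unfolding has_field_derivative_def by (simp only:)
  qed
  have g': "((\<lambda>s. g i (x + s *\<^sub>R d) t \<bullet> d) has_real_derivative (H i (x + s *\<^sub>R d) t *v d) \<bullet> d) (at s)" for s
  proof -
    have "((\<lambda>s. g i (x + s *\<^sub>R d) t) has_derivative (\<lambda>h. H i (x + s *\<^sub>R d) t *v (h *\<^sub>R d))) (at s)"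
      by (rule has_derivative_compose[OF line hessian[OF assms(1)]])
    then have "((\<lambda>s. g i (x + s *\<^sub>R d) t) has_vector_derivative H i (x + s *\<^sub>R d) t *v d) (at s)"
      by (simp add: has_vector_derivative_def matrix_vector_mult_scaleR)
    then show ?thesis
      unfolding has_real_derivative_iff_has_vector_derivative
      by (rule bounded_linear.has_vector_derivative[OF bounded_linear_inner_left])
  qed
  have pos: "0 < (H i (x + s *\<^sub>R d) t *v d) \<bullet> d" for s
  proof -
    have "0 < \<theta>l i * (norm d)\<^sup>2" using theta_pos(1) \<open>d \<noteq> 0\<close> by simp
    also have "\<dots> \<le> d \<bullet> (H i (x + s *\<^sub>R d) t *v d)"
      by (rule loewner_lower[OF hessian_lower[OF assms(1)] hessian_upper[OF assms(1)] theta_pos])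
    finally show ?thesis by (simp add: inner_commute)
  qed
  \<comment> \<open>The mean value point is strictly inside the segment, where the slope already
    exceeds the one at \<open>x\<close>.\<close>
  obtain z where z: "0 < z" "z < 1" "f i (x + 1 *\<^sub>R d) t - f i (x + 0 *\<^sub>R d) t = (1 - 0) * (g i (x + z *\<^sub>R d) t \<bullet> d)"
    using MVT2[of 0 1 "\<lambda>s. f i (x + s *\<^sub>R d) t" "\<lambda>s. g i (x + s *\<^sub>R d) t \<bullet> d"] f' by auto
  have "g i (x + 0 *\<^sub>R d) t \<bullet> d < g i (x + z *\<^sub>R d) t \<bullet> d"
    using z(1) by (rule DERIV_pos_imp_increasing) (use g' pos in blast)
  then show ?thesis using z(3) by (simp add: d_def)
qed

text \<open>Connectedness makes every feasible tuple constant, and strict convexity makes the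
  critical point beat every other constant tuple. The strict inequality yields minimality and the
  uniqueness demanded by \<open>THE\<close>.\<close>

lemma optimal_trajectory_eqI:
  assumes t: "0 \<le> t" and crit: "(\<Sum>i\<in>UNIV. g i x t) = 0"
  shows "optimal_trajectory f E t = x"
  unfolding optimal_trajectory_def
proof (rule the_equality)
  let ?F = "\<lambda>Y :: (real^'n)^'v::{finite,linorder}. \<Sum>i\<in>UNIV. f i (Y $ i) t"
  let ?P = "\<lambda>Y :: (real^'n)^'v::{finite,linorder}. \<forall>(i, j)\<in>E. Y $ i = Y $ j"
  have less: "?F (\<chi> i. x) < ?F (\<chi> i. y)" if "y \<noteq> x" for y
  proof -
    have "?F (\<chi> i. x) = (\<Sum>i\<in>UNIV. f i x t + g i x t \<bullet> (y - x))"
      by (simp add: sum.distrib crit flip: inner_sum_left)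
    also have "\<dots> < (\<Sum>i\<in>UNIV. f i y t)"
      by (intro sum_strict_mono gradient_strict_convex t that) auto
    finally show ?thesis by simp
  qed
  show "is_arg_min ?F ?P (\<chi> i. x)"
    unfolding is_arg_min_def
  proof (intro conjI notI)
    assume "\<exists>Y. ?P Y \<and> ?F Y < ?F (\<chi> i. x)"
    then obtain Y where Y: "?P Y" "?F Y < ?F (\<chi> i. x)" by blast
    fix i0
    have "Y $ i = Y $ i0" for i
    proof -
      have "(i, i0) \<in> E\<^sup>*" using connected by (simp add: connected_graph_def)
      then show ?thesis by induction (use Y(1) in auto)
    qed
    then have "Y = (\<chi> i. Y $ i0)" by (simp add: vec_eq_iff)
    then show False using less[of "Y $ i0"] Y(2) by (metis less_asym less_irrefl)
  qed auto
  show "y = x" if "is_arg_min ?F ?P (\<chi> i. y)" for y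
  proof (rule ccontr)
    assume "y \<noteq> x"
    moreover have "?P (\<chi> i. x)" by auto
    ultimately show False using that less unfolding is_arg_min_def by blast
  qed
qed

section \<open>Decay of the disagreement to zero in finite time\<close>

lemma finite_time_consensus:
  fixes e :: "'m::finite \<Rightarrow> 'v set" and B :: "real^('m \<times> 'n)^('v::{finite,linorder} \<times> 'n)"
  assumes e: "bij_betw e UNIV (undirected_edges E)"
    and B: "B = kronecker (weighted_incidence A e) (mat 1 :: real^'n^'n)"
    and alpha: "\<alpha> > \<kappa> * sqrt (real CARD('v) * Max (range \<theta>u) / (Min (range \<theta>l) * lambda2 (transpose B ** B)))"
    and T0: "0 \<le> T0" "\<And>t i. T0 \<le> t \<Longrightarrow> Z t $ i = 0"
  obtains T where "T0 \<le> T" "\<And>t. T \<le> t \<Longrightarrow> disagreement A (X t) = 0"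
proof -
  define l0 where "l0 = Min (range \<theta>l)"
  define u0 where "u0 = Max (range \<theta>u)"
  define \<Lambda> where "\<Lambda> = lambda2 (transpose B ** B)"
  define \<beta> where "\<beta> = \<kappa> * sqrt (real CARD('v) * u0 / (l0 * \<Lambda>))"
  have l0: "0 < l0" "\<And>i. l0 \<le> \<theta>l i"
    using theta_pos(1) by (auto simp: l0_def Min_gr_iff)
  have u0: "\<And>i. \<theta>u i \<le> u0" by (auto simp: u0_def)
  then have u0_pos: "0 < u0" using theta_pos(2) order_less_le_trans by blast
  have \<Lambda>: "0 < \<Lambda>"
    unfolding \<Lambda>_def B by (rule lambda2_gram_pos[OF kronecker_incidence_neq_0[OF e]])
  have \<beta>: "0 < \<beta>" "\<beta> < \<alpha>"
    using alpha kappa_pos l0(1) u0_pos \<Lambda> by (auto simp: \<beta>_def l0_def u0_def \<Lambda>_def)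
  have "\<beta>\<^sup>2 = \<kappa>\<^sup>2 * (real CARD('v) * u0 / (l0 * \<Lambda>))"
    using l0(1) u0_pos \<Lambda> by (simp add: \<beta>_def power_mult_distrib)
  then have \<beta>2: "\<beta>\<^sup>2 * \<Lambda> * l0 = real CARD('v) * \<kappa>\<^sup>2 * u0"
    using l0(1) \<Lambda> by (simp add: field_simps)
  define c where "c = (\<alpha> - \<beta>) * (\<Lambda> / u0)"
  have c: "0 < c" using \<beta> \<Lambda> u0_pos by (simp add: c_def)
  let ?V = "\<lambda>t. disagreement A (X t)"
  obtain N1 where N1: "negligible N1" "\<And>t. t \<notin> N1 \<Longrightarrow> 0 \<le> t \<Longrightarrow>
    \<exists>v. v \<in> filippov_map (protocol_rhs A \<alpha> H dg \<phi>) t (X t, Z t) \<and>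
      ((\<lambda>t. (X t, Z t)) has_vector_derivative v) (at t)"
    by (rule inclusion_ae) blast
  obtain N2 where N2: "negligible N2" "\<And>t v. t \<notin> N2 \<Longrightarrow> (X has_vector_derivative v) (at t) \<Longrightarrow>
    \<exists>D. (?V has_real_derivative D) (at t)"
    by (rule disagreement_differentiable_ae) blast
  \<comment> \<open>Excluding \<open>T0\<close> leaves times around which the auxiliary variables
    vanish on a whole neighbourhood, so that their velocity is 0.\<close>
  define N where "N = insert T0 (N1 \<union> N2)"
  have N: "negligible N" using N1(1) N2(1) by (simp add: N_def negligible_Un)
  have rate: "\<exists>D. (?V has_real_derivative D) (at t) \<and> D \<le> 0 \<and> (0 < ?V t \<longrightarrow> D \<le> - c)"
    if t: "T0 \<le> t" "t \<notin> N" for t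
  proof -
    have "T0 < t" "0 \<le> t" using t T0(1) by (auto simp: N_def)
    obtain v where v: "v \<in> filippov_map (protocol_rhs A \<alpha> H dg \<phi>) t (X t, Z t)"
      "((\<lambda>t. (X t, Z t)) has_vector_derivative v) (at t)"
      using N1(2)[of t] t(2) \<open>0 \<le> t\<close> unfolding N_def by blast
    note Xv = state_derivative_components(1)[OF v(2)]
    obtain D where D: "(?V has_real_derivative D) (at t)"
      using N2(2)[OF _ Xv] t by (auto simp: N_def)
    have vZ: "snd v $ i = 0" for i
    proof -
      have "((\<lambda>t. Z t $ i) has_vector_derivative 0) (at t)"
      proof (rule has_vector_derivative_transform_within_open[of "\<lambda>_. 0" _ _ "{T0<..}"])
        show "((\<lambda>_. 0 :: real^'n) has_vector_derivative 0) (at t)" by simp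
      qed (use \<open>T0 < t\<close> T0(2) in auto)
      then show ?thesis
        using state_derivative_components(3)[OF v(2)] vector_derivative_unique_at by blast
    qed
    define \<eta> where "\<eta> = (1 / \<alpha>) *\<^sub>R feedback t (X t) v"
    have le: "\<eta> \<bullet> Y \<le> disagreement A Y" for Y
      using feedback_le_disagreement[OF v(1) \<open>0 \<le> t\<close>, of Y] alpha_pos by (simp add: \<eta>_def field_simps)
    have ge: "?V t \<le> \<eta> \<bullet> X t"
      using feedback_ge_disagreement[OF v(1) \<open>0 \<le> t\<close>] alpha_pos by (simp add: \<eta>_def field_simps)
    have D_eq: "D = \<eta> \<bullet> fst v" by (rule deriv_disagreement[OF D Xv le ge])
    have "D \<le> - c" if "0 < ?V t"
      unfolding D_eq c_def
    proof (rule subgradient_descent_rate[where M = "\<lambda>i. H i (X t $ i) t" and l = \<theta>l and u = \<theta>u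
          and d = "\<chi> i. dg i (X t $ i) t"])
      show "H i (X t $ i) t *v (fst v $ i) = - (\<alpha> *\<^sub>R \<eta> $ i + (\<chi> i. dg i (X t $ i) t) $ i)" for i
        using alpha_pos by (simp add: \<eta>_def feedback_def vZ)
      show "\<Lambda> \<le> (norm \<eta>)\<^sup>2"
        unfolding \<Lambda>_def B by (rule lambda2_le_norm_subgradient[OF e le ge that])
    qed (use hessian_lower[OF \<open>0 \<le> t\<close>] hessian_upper[OF \<open>0 \<le> t\<close>] l0 u0 theta_pos dg_bound[OF \<open>0 \<le> t\<close>]
        \<Lambda> \<beta> \<beta>2 in auto)
    \<comment> \<open>At a zero the nonnegative disagreement is minimal, which rules out a renewed
      increase once consensus is reached.\<close>
    moreover have "D = 0" if "?V t = 0"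
    proof (rule DERIV_local_min[OF D, of 1])
      show "\<forall>s. \<bar>t - s\<bar> < 1 \<longrightarrow> ?V t \<le> ?V s" using that by (simp add: disagreement_nonneg)
    qed simp
    moreover have "?V t = 0 \<or> 0 < ?V t" using disagreement_nonneg[of "X t"] by linarith
    ultimately show ?thesis using D c by force
  qed
  have "\<exists>T\<ge>T0. ?V T = 0"
  proof (rule ccontr)
    assume "\<not> ?thesis"
    then have pos: "0 < ?V t" if "T0 \<le> t" for t
      using that disagreement_nonneg[of "X t"] by (metis order_le_less)
    \<comment> \<open>The time at which decay at rate \<open>c\<close> would have used up the
      disagreement present at \<open>T0\<close>.\<close>
    define b where "b = T0 + ?V T0 / c"
    have "T0 \<le> b" using c disagreement_nonneg[of "X T0"] by (simp add: b_def)
    have "?V b - ?V T0 \<le> - c * (b - T0)"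
      by (rule absolutely_continuous_fun_deriv_le[OF ac_disagreement[OF T0(1) \<open>T0 \<le> b\<close>] \<open>T0 \<le> b\<close> N])
        (use rate pos in blast)
    also have "\<dots> = - ?V T0" using c by (simp add: b_def)
    finally show False using pos[OF \<open>T0 \<le> b\<close>] by simp
  qed
  then obtain T where T: "T0 \<le> T" "?V T = 0" by blast
  have "?V t = 0" if "T \<le> t" for t
  proof -
    have "?V t - ?V T \<le> 0 * (t - T)"
    proof (rule absolutely_continuous_fun_deriv_le[OF ac_disagreement _ N])
      fix s assume "T \<le> s" "s \<notin> N"
      then show "\<exists>D\<le>0. (?V has_real_derivative D) (at s)" using rate[of s] T(1) by auto
    qed (use that T(1) T0(1) in auto)
    then show ?thesis using T(2) disagreement_nonneg[of "X t"] by simp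
  qed
  then show ?thesis using that T(1) by blast
qed

end

theorem theorem2:
  fixes E :: "('v::{finite,linorder} \<times> 'v) set"
    and A :: "real^'v::{finite,linorder}^'v::{finite,linorder}"
    and e :: "'m::finite \<Rightarrow> 'v set"
    and f :: "'v \<Rightarrow> real^'n \<Rightarrow> real \<Rightarrow> real"
    and g :: "'v \<Rightarrow> real^'n \<Rightarrow> real \<Rightarrow> real^'n"
    and H :: "'v \<Rightarrow> real^'n \<Rightarrow> real \<Rightarrow> real^'n^'n"
    and dg :: "'v \<Rightarrow> real^'n \<Rightarrow> real \<Rightarrow> real^'n"
    and \<theta>l \<theta>u :: "'v \<Rightarrow> real"
    and \<kappa> \<alpha> :: real
    and \<phi> :: "'v \<Rightarrow> real^'n \<Rightarrow> real^'n"
    and X0 :: "'v \<Rightarrow> (real^'n) set"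
    and B :: "real^('m \<times> 'n)^('v \<times> 'n)"
    and X Z :: "real \<Rightarrow> (real^'n)^'v::{finite,linorder}"
  assumes graph: "undirected_weighted_graph E A" "connected_graph E"
    and edges: "bij_betw e UNIV (undirected_edges E)"
    and B: "B = kronecker (weighted_incidence A e) (mat 1 :: real^'n^'n)"
    and gradient: "\<And>i x t. 0 \<le> t \<Longrightarrow> GDERIV (\<lambda>y. f i y t) x :> g i x t"
    and hessian: "\<And>i x t. 0 \<le> t \<Longrightarrow> ((\<lambda>y. g i y t) has_derivative (\<lambda>h. H i x t *v h)) (at x)"
    and hessian_cont: "\<And>i t. 0 \<le> t \<Longrightarrow> continuous_on UNIV (\<lambda>x. H i x t)"
    and theta_pos: "\<And>i. 0 < \<theta>l i" "\<And>i. 0 < \<theta>u i"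
    and hessian_lower: "\<And>i x t. 0 \<le> t \<Longrightarrow> loewner_le (\<theta>l i *\<^sub>R mat 1) (H i x t)"
    and hessian_upper: "\<And>i x t. 0 \<le> t \<Longrightarrow> loewner_le (H i x t) (\<theta>u i *\<^sub>R mat 1)"
    and dg: "\<And>i x t. 0 \<le> t \<Longrightarrow>
              ((\<lambda>s. g i x s) has_vector_derivative dg i x t) (at t within {0..})"
    and dg_measurable: "\<And>i x. (\<lambda>t. dg i x t) \<in> borel_measurable (lebesgue_on {0..})"
    and dg_cont: "\<And>i t. 0 \<le> t \<Longrightarrow> continuous_on UNIV (\<lambda>x. dg i x t)"
    and kappa_pos: "0 < \<kappa>"
    and dg_bound: "\<And>i x t. 0 \<le> t \<Longrightarrow> norm (dg i x t) \<le> \<kappa>"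
    and phi_bounded: "\<And>i. locally_essentially_bounded (\<phi> i)"
    and phi_stable: "\<And>i. ft_stable (\<lambda>z. - \<phi> i z) (X0 i)"
    and alpha: "\<alpha> > \<kappa> * sqrt (real CARD('v) * Max (range \<theta>u) /
                              (Min (range \<theta>l) * lambda2 (transpose B ** B)))"
    and solution: "filippov_solution (protocol_rhs A \<alpha> H dg \<phi>) (\<lambda>t. (X t, Z t))"
    and init: "\<And>i. Z 0 $ i = g i (X 0 $ i) 0" "\<And>i. Z 0 $ i \<in> X0 i"
  shows "(\<forall>i. \<exists>T. settles_at (\<lambda>t. Z t $ i) T) \<and>
         (\<exists>T\<ge>0. \<forall>i. ((\<lambda>t. norm (X t $ i - optimal_trajectory f E t)) \<longlongrightarrow> 0)
                       (at T within {0..}))"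
proof -
  interpret G: weighted_graph E A by unfold_locales (rule graph)
  have "0 < lambda2 (transpose B ** B)"
    unfolding B by (rule lambda2_gram_pos[OF G.kronecker_incidence_neq_0[OF edges]])
  moreover have "0 < Min (range \<theta>l)" using theta_pos(1) by (simp add: Min_gr_iff)
  moreover have "0 < Max (range \<theta>u)" using theta_pos(2) by (simp add: Max_gr_iff)
  ultimately have "0 \<le> \<kappa> * sqrt (real CARD('v) * Max (range \<theta>u) / (Min (range \<theta>l) * lambda2 (transpose B ** B)))"
    using kappa_pos by (intro mult_nonneg_nonneg real_sqrt_ge_zero divide_nonneg_nonneg less_imp_le) auto
  then have "0 < \<alpha>" using alpha by linarith
  interpret P: tracking_protocol E A f g H dg \<theta>l \<theta>u \<kappa> \<alpha> \<phi> X Z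
    by unfold_locales (rule graph(2) gradient hessian hessian_cont theta_pos hessian_lower hessian_upper dg
      dg_measurable dg_cont kappa_pos dg_bound phi_bounded \<open>0 < \<alpha>\<close> solution; assumption)+
  have "\<exists>T. settles_at (\<lambda>t. Z t $ i) T" for i
    using phi_stable[of i] P.auxiliary_solution[of i] init(2)[of i] unfolding ft_stable_def by blast
  then obtain S where S: "\<And>i. settles_at (\<lambda>t. Z t $ i) (S i)" by metis
  define T0 where "T0 = Max (range S)"
  have S_le: "S i \<le> T0" for i by (simp add: T0_def)
  have T0: "0 \<le> T0" using S S_le order_trans unfolding settles_at_def by blast
  have Z0: "Z t $ i = 0" if "T0 \<le> t" for t i
    using S[of i] S_le[of i] that by (simp add: settles_at_def)
  obtain T where T: "T0 \<le> T" "\<And>t. T \<le> t \<Longrightarrow> disagreement A (X t) = 0"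
    using P.finite_time_consensus[OF edges B alpha T0 Z0] by blast
  have track: "X t $ i = optimal_trajectory f E t" if "T \<le> t" for t i
  proof -
    have "0 \<le> t" using that T0 T(1) by simp
    \<comment> \<open>At consensus with settled auxiliary variables, the total gradient at the
      common point is the conserved sum, whose value is fixed to 0 by the initial condition.\<close>
    have "(\<Sum>j\<in>UNIV. g j (X t $ i) t) = (\<Sum>j\<in>UNIV. g j (X t $ j) t - Z t $ j)"
    proof (rule sum.cong[OF refl])
      fix j
      have "X t $ j = X t $ i"
        by (rule G.disagreement_eq_0_connected[OF T(2)[OF that] graph(2)])
      moreover have "Z t $ j = 0" using that T(1) by (intro Z0) simp
      ultimately show "g j (X t $ i) t = g j (X t $ j) t - Z t $ j" by simp
    qed
    also have "\<dots> = 0"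
      unfolding P.sum_gradient_minus_auxiliary_const[OF \<open>0 \<le> t\<close>] by (simp add: init(1))
    finally show ?thesis using P.optimal_trajectory_eqI[OF \<open>0 \<le> t\<close>] by metis
  qed
  \<comment> \<open>Tracking is known from \<open>T\<close> on, but the limit also approaches from
    the left; at \<open>T + 1\<close> equality holds on both sides.\<close>
  have "((\<lambda>t. norm (X t $ i - optimal_trajectory f E t)) \<longlongrightarrow> 0) (at (T + 1) within {0..})" for i
  proof (rule tendsto_eventually)
    have "\<forall>\<^sub>F t in at (T + 1) within {0..}. T < t"
      by (rule order_tendstoD(1)[OF tendsto_ident_at]) simp
    then show "\<forall>\<^sub>F t in at (T + 1) within {0..}. norm (X t $ i - optimal_trajectory f E t) = 0"
      by eventually_elim (use track[of _ i] in auto)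
  qed
  moreover have "0 \<le> T + 1" using T0 T(1) by simp
  ultimately show ?thesis using S by blast
qed
end
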